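(* Let $p_d(x)=\exp(-E(x))/Z$ be a target density on $\mathbb{R}^n$, where $E:\mathbb{R}^n\to\mathbb{R}$ is a lower-bounded differentiable energy function and $Z=\int\exp(-E(x))\,dx$. Let $p_\theta(x)=\int\delta(x-g_\theta(z))\,p(z)\,dz$ be the model with parameter $\theta$, where $p(z)=\mathcal{N}(z\mid 0,I)$ and $g_\theta$ is a deterministic generator (a neural network with parameters $\theta$). Let $k_t(x_t\mid x)=\mathcal{N}(x_t\mid\alpha_t x,\sigma_t^2I)$ be a Gaussian kernel, let $p_\theta(x_t)=\int k_t(x_t\mid x)p_\theta(x)\,dx$ and $p_d(x_t)=\int k_t(x_t\mid x)p_d(x)\,dx$ be the convolved model and target densities, and let the reverse diffusive KL divergence with the single kernel $k_t$ be $$\mathrm{DiKL}_{k_t}(p_\theta\|p_d)=\int p_\theta(x_t)\left(\log p_\theta(x_t)-\log p_d(x_t)\right)dx_t .$$ Then the gradient with respect to the model parameter $\theta$ is $$\nabla_\theta\,\mathrm{DiKL}_{k_t}(p_\theta\|p_d)=\int p_\theta(x_t)\left(\nabla_{x_t}\log p_\theta(x_t)-\nabla_{x_t}\log p_d(x_t)\right)\frac{\partial x_t}{\partial\theta}\,dx_t .$$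
   Context: The same symbols $p_\theta$, $p_d$ denote the original and the convolved densities, distinguished by their arguments: $p_\theta(x)$, $p_d(x)$ are the original model and target, while $p_\theta(x_t)$, $p_d(x_t)$ are their convolutions with $k_t$. The divergence $\mathrm{DiKL}_{k_t}(p_\theta\|p_d)$ is thus the KL divergence from the convolved model to the convolved target. The model law $p_\theta(x)$ need not have a density with respect to Lebesgue measure. The Jacobian $\frac{\partial x_t}{\partial\theta}$ refers to the reparameterization $x_t=\alpha_t g_\theta(z)+\sigma_t\epsilon_t$ with $z\sim\mathcal{N}(0,I)$ and $\epsilon_t\sim\mathcal{N}(0,I)$ independent, and the integral against $p_\theta(x_t)\,dx_t$ is read as the expectation over $(z,\epsilon_t)$ with this $x_t$ substituted. The gradients $\nabla_{x_t}$ act on the variable $x_t$ only. The formula is stated without explicit regularity conditions.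
   Formalization: Added: Z finite, σ_t>0, g_θ measurable in z, E|g_θ(z)|² finite at θ, g differentiable in θ for a.e. z, and |g_θ'(z)−g_θ(z)| ≤ h(z)|θ'−θ| near θ with h square-integrable; without regularity the formula fails, e.g. for g_θ(z)=1[z>θ]. *)

theory Defs
  imports "HOL-Analysis.Analysis"
begin

text \<open>Density of the isotropic normal distribution with mean \<open>\<mu>\<close> and covariance \<open>\<sigma>\<^sup>2 I\<close>;
  \<open>\<sigma>\<close> is the standard deviation.\<close>

definition gauss_density :: "real^'n \<Rightarrow> real \<Rightarrow> real^'n \<Rightarrow> real" where
  "gauss_density \<mu> \<sigma> x =
     exp (- (norm (x - \<mu>))\<^sup>2 / (2 * \<sigma>\<^sup>2)) / sqrt (2 * pi * \<sigma>\<^sup>2) ^ CARD('n)"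

text \<open>The measure is taken on the Lebesgue (not Borel) sets, so that it is complete: a Jacobian
  that exists only almost everywhere is then measurable no matter how it is extended.\<close>

definition std_gaussian :: "(real^'m) measure" where
  "std_gaussian = density lebesgue (\<lambda>z. ennreal (gauss_density 0 1 z))"

definition partition_const :: "(real^'n \<Rightarrow> real) \<Rightarrow> real" where
  "partition_const E = (\<integral>x. exp (- E x) \<partial>lborel)"

definition target_law :: "(real^'n \<Rightarrow> real) \<Rightarrow> (real^'n) measure" where
  "target_law E = density lborel (\<lambda>x. ennreal (exp (- E x) / partition_const E))"

text \<open>The law of \<open>g \<theta> z\<close> for standard normal \<open>z\<close>. It is a measure since
  \<open>\<integral> \<delta>(x - g \<theta> z) p(z) dz\<close> need not be a function of \<open>x\<close>.\<close>

definition model_law :: "('p \<Rightarrow> real^'m \<Rightarrow> real^'n) \<Rightarrow> 'p \<Rightarrow> (real^'n) measure" where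
  "model_law g \<theta> = distr std_gaussian borel (g \<theta>)"

text \<open>The density \<open>x\<^sub>t \<mapsto> \<integral> k(x\<^sub>t | x) M(dx)\<close> for the kernel \<open>k(\<cdot> | x) = N(\<alpha> x, \<sigma>\<^sup>2 I)\<close>.\<close>

definition convolved_density :: "real \<Rightarrow> real \<Rightarrow> (real^'n) measure \<Rightarrow> real^'n \<Rightarrow> real" where
  "convolved_density \<alpha> \<sigma> M xt = (\<integral>x. gauss_density (\<alpha> *\<^sub>R x) \<sigma> xt \<partial>M)"

definition DiKL_integrand ::
    "real \<Rightarrow> real \<Rightarrow> (real^'n) measure \<Rightarrow> (real^'n) measure \<Rightarrow> real^'n \<Rightarrow> real" where
  "DiKL_integrand \<alpha> \<sigma> P Q xt =
     convolved_density \<alpha> \<sigma> P xt *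
       (ln (convolved_density \<alpha> \<sigma> P xt) - ln (convolved_density \<alpha> \<sigma> Q xt))"

definition DiKL :: "real \<Rightarrow> real \<Rightarrow> (real^'n) measure \<Rightarrow> (real^'n) measure \<Rightarrow> real" where
  "DiKL \<alpha> \<sigma> P Q = (\<integral>xt. DiKL_integrand \<alpha> \<sigma> P Q xt \<partial>lborel)"

text \<open>The vector of partial derivatives; meaningful only where \<open>f\<close> is differentiable.\<close>

definition grad :: "(real^'n \<Rightarrow> real) \<Rightarrow> real^'n \<Rightarrow> real^'n" where
  "grad f x = (\<chi> i. frechet_derivative f (at x) (axis i 1))"

definition score :: "real \<Rightarrow> real \<Rightarrow> (real^'n) measure \<Rightarrow> real^'n \<Rightarrow> real^'n" where
  "score \<alpha> \<sigma> M = grad (\<lambda>xt. ln (convolved_density \<alpha> \<sigma> M xt))"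

definition noised_sample ::
    "real \<Rightarrow> real \<Rightarrow> ('p \<Rightarrow> real^'m \<Rightarrow> real^'n) \<Rightarrow> real^'m \<Rightarrow> real^'n \<Rightarrow> 'p \<Rightarrow> real^'n" where
  "noised_sample \<alpha> \<sigma> g z \<epsilon> \<theta> = \<alpha> *\<^sub>R g \<theta> z + \<sigma> *\<^sub>R \<epsilon>"

text \<open>The integrand of the gradient formula at the latent \<open>z\<close> and the noise \<open>\<epsilon>\<close>: the row vector
  of score differences at \<open>x\<^sub>t\<close> times the Jacobian of \<open>x\<^sub>t\<close> in \<open>\<theta>\<close>.\<close>

definition DiKL_grad_integrand ::
    "real \<Rightarrow> real \<Rightarrow> (real^'p \<Rightarrow> real^'m \<Rightarrow> real^'n) \<Rightarrow> (real^'n) measure \<Rightarrow> real^'p \<Rightarrow>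
       real^'m \<Rightarrow> real^'n \<Rightarrow> real^'p" where
  "DiKL_grad_integrand \<alpha> \<sigma> g Q \<theta> z \<epsilon> =
     (let xt = noised_sample \<alpha> \<sigma> g z \<epsilon> \<theta> in
       (score \<alpha> \<sigma> (model_law g \<theta>) xt - score \<alpha> \<sigma> Q xt)
         v* jacobian (noised_sample \<alpha> \<sigma> g z \<epsilon>) (at \<theta>))"

end

theory Submission
  imports Defs "HOL-Probability.Distributions"
begin

text \<open>Fix the base parameter \<open>\<theta>\<close> and write \<open>p', p, q\<close> for the convolved densities of the model at
  \<open>\<theta>'\<close>, of the model at \<open>\<theta>\<close> and of the target, and \<open>x'\<close> for the noised sample at \<open>\<theta>'\<close>, whose density
  is \<open>p'\<close>. Then the divergence at \<open>\<theta>'\<close> is the expectation of \<open>(ln p - ln q)(x')\<close> plus the relative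
  entropy of \<open>p'\<close> with respect to \<open>p\<close>.

  In the first term the function is fixed and only the sample moves. The score of every Gaussian
  smoothing of a probability measure grows at most linearly, so dominated convergence permits
  differentiation under the expectation, and this yields the claimed gradient. The second term has
  derivative zero: by convexity of the relative entropy it is at most
  \<open>\<alpha>\<^sup>2 / (2 \<sigma>\<^sup>2)\<close> times the mean of \<open>(norm (g \<theta>' z - g \<theta> z))\<^sup>2\<close>, which is \<open>O((norm (\<theta>' - \<theta>))\<^sup>2)\<close>.\<close>

section \<open>Differentiation under the integral sign\<close>

text \<open>The usual argument differentiates the density in the parameter and discards the mean of
  its logarithmic derivative. Here \<open>p'\<close> is never differentiated in the parameter; the
  discarded term is squeezed instead: Gibbs' inequality bounds it below by zero, and a coupling
  through a common latent bounds it above quadratically. The constant is the relative entropy of two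
  normal laws with covariance \<open>\<sigma>\<^sup>2 I\<close> and means \<alpha> a and \<alpha> b,
  namely the squared norm of \<alpha> (a - b) over \<open>2 * \<sigma>\<^sup>2\<close>. Linear
  growth of the score rests on a Gaussian lower bound for every smoothed density. Log densities then
  grow at most quadratically, so second moments of the generator dominate all integrands. A separate
  obstacle is measurability. The Jacobian takes default values where the generator is not
  differentiable, which is harmless on the complete latent space, but the product with the noise is
  not complete. The Jacobian is therefore shown measurable in the latent alone and then pulled back
  along the projection.\<close>

lemma has_derivative_imp_LIMSEQ_quotient:
  fixes f :: "'a::real_normed_vector \<Rightarrow> 'b::real_normed_vector"
  assumes "(f has_derivative D) (at x)"
  shows "(\<lambda>n. real (Suc n) *\<^sub>R (f (x + v /\<^sub>R real (Suc n)) - f x)) \<longlonglongrightarrow> D v"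
proof -
  interpret D: bounded_linear D
    using assms by (rule has_derivative_bounded_linear)
  have "((\<lambda>t::real. x + t *\<^sub>R v) has_derivative (\<lambda>t. t *\<^sub>R v)) (at 0)"
    by (auto intro!: derivative_eq_intros)
  then have "((\<lambda>t. f (x + t *\<^sub>R v)) has_derivative (\<lambda>t. D (t *\<^sub>R v))) (at 0)"
    using assms by (auto intro: has_derivative_compose)
  then have "((\<lambda>t. f (x + t *\<^sub>R v)) has_vector_derivative D v) (at 0)"
    by (simp add: has_vector_derivative_def D.scaleR)
  then have lim: "((\<lambda>t. norm (f (x + t *\<^sub>R v) - f x - t *\<^sub>R D v) / norm t) \<longlongrightarrow> 0) (at 0)"
    by (simp add: has_vector_derivative_def has_derivative_at)
  have "filterlim (\<lambda>n. inverse (real (Suc n))) (at 0) sequentially"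
    using LIMSEQ_inverse_real_of_nat by (auto simp: filterlim_at)
  from filterlim_compose[OF lim this]
  have "(\<lambda>n. norm (f (x + inverse (real (Suc n)) *\<^sub>R v) - f x - inverse (real (Suc n)) *\<^sub>R D v)
      / norm (inverse (real (Suc n)))) \<longlonglongrightarrow> 0" .
  moreover have "norm (f (x + inverse (real (Suc n)) *\<^sub>R v) - f x - inverse (real (Suc n)) *\<^sub>R D v)
      / norm (inverse (real (Suc n)))
    = norm (real (Suc n) *\<^sub>R (f (x + v /\<^sub>R real (Suc n)) - f x) - D v)" for n
  proof -
    have "real (Suc n) *\<^sub>R (f (x + v /\<^sub>R real (Suc n)) - f x) - D v
      = real (Suc n) *\<^sub>R (f (x + inverse (real (Suc n)) *\<^sub>R v) - f x - inverse (real (Suc n)) *\<^sub>R D v)"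
      by (simp add: scaleR_right_diff_distrib del: of_nat_Suc)
    then show ?thesis
      by (simp add: divide_inverse mult.commute del: of_nat_Suc)
  qed
  ultimately have "(\<lambda>n. norm (real (Suc n) *\<^sub>R (f (x + v /\<^sub>R real (Suc n)) - f x) - D v)) \<longlonglongrightarrow> 0"
    by (simp del: of_nat_Suc)
  then have "(\<lambda>n. real (Suc n) *\<^sub>R (f (x + v /\<^sub>R real (Suc n)) - f x) - D v) \<longlonglongrightarrow> 0"
    by (rule tendsto_norm_zero_cancel)
  then show ?thesis
    by (rule LIM_zero_cancel)
qed

text \<open>The derivative along \<open>v\<close> is a limit of difference quotients based at
  \<open>x\<close>, so a Lipschitz bound centred at that single point already controls it. This
  supplies the dominating function for the derivative below.\<close>

lemma has_derivative_norm_le: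
  fixes f :: "'a::real_normed_vector \<Rightarrow> 'b::real_normed_vector"
  assumes D: "(f has_derivative D) (at x)" and "0 < r"
    and lip: "\<And>y. y \<in> ball x r \<Longrightarrow> norm (f y - f x) \<le> B * norm (y - x)"
  shows "norm (D v) \<le> B * norm v"
proof -
  have "(\<lambda>n. v /\<^sub>R real (Suc n)) \<longlonglongrightarrow> 0 *\<^sub>R v"
    by (intro tendsto_scaleR LIMSEQ_inverse_real_of_nat tendsto_const)
  then have "(\<lambda>n. norm (v /\<^sub>R real (Suc n))) \<longlonglongrightarrow> 0"
    using tendsto_norm_zero by fastforce
  then have ev: "\<forall>\<^sub>F n in sequentially. norm (v /\<^sub>R real (Suc n)) < r"
    using \<open>0 < r\<close> by (rule order_tendstoD)
  have "\<forall>\<^sub>F n in sequentially.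
      norm (real (Suc n) *\<^sub>R (f (x + v /\<^sub>R real (Suc n)) - f x)) \<le> B * norm v"
    using ev
  proof eventually_elim
    case (elim n)
    have "norm (f (x + v /\<^sub>R real (Suc n)) - f x) \<le> B * norm (v /\<^sub>R real (Suc n))"
      using lip[of "x + v /\<^sub>R real (Suc n)"] elim by (simp add: dist_norm)
    then have "real (Suc n) * norm (f (x + v /\<^sub>R real (Suc n)) - f x)
        \<le> real (Suc n) * (B * norm (v /\<^sub>R real (Suc n)))"
      by (rule mult_left_mono) simp
    also have "\<dots> = B * norm v"
      by (simp add: field_simps)
    finally show ?case
      by (simp del: of_nat_Suc)
  qed
  then show ?thesis
    by (intro tendsto_upperbound[OF tendsto_norm[OF has_derivative_imp_LIMSEQ_quotient[OF D]]])
       simp_all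
qed

text \<open>Dominated convergence is applied to the normalised remainder. The increment and the
  linear part are each at most \<open>h z * norm v\<close>, hence the majorant
  \<open>2 * h z\<close>. Differentiability and the Lipschitz bound are centred at
  \<open>x0\<close>, so the derivative may exist at that point only.\<close>

lemma
  fixes f :: "'a::real_normed_vector \<Rightarrow> 'b \<Rightarrow> real"
  assumes r: "0 < r"
    and int: "\<And>x. x \<in> ball x0 r \<Longrightarrow> integrable M (f x)"
    and diff: "AE z in M. ((\<lambda>x. f x z) has_derivative D z) (at x0)"
    and meas: "\<And>v. (\<lambda>z. D z v) \<in> borel_measurable M"
    and lip: "AE z in M. \<forall>x\<in>ball x0 r. \<bar>f x z - f x0 z\<bar> \<le> h z * norm (x - x0)"
    and h: "integrable M h"
  shows has_derivative_integral_integrable: "integrable M (\<lambda>z. D z v)"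
    and has_derivative_integral: "((\<lambda>x. \<integral>z. f x z \<partial>M) has_derivative (\<lambda>v. \<integral>z. D z v \<partial>M)) (at x0)"
proof -
  have bound: "AE z in M. \<forall>v. \<bar>D z v\<bar> \<le> h z * norm v"
    using diff lip
  proof eventually_elim
    case (elim z)
    then show ?case
      using has_derivative_norm_le[OF elim(1) r, of "h z"] by auto
  qed
  have int_D: "integrable M (\<lambda>z. D z v)" for v
    using bound
    by (intro Bochner_Integration.integrable_bound[OF integrable_mult_left[OF h, of "norm v"] meas])
       (auto elim!: eventually_mono intro: order_trans)
  then show "integrable M (\<lambda>z. D z v)" .
  show "((\<lambda>x. \<integral>z. f x z \<partial>M) has_derivative (\<lambda>v. \<integral>z. D z v \<partial>M)) (at x0)"
    unfolding has_derivative_at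
  proof
    show "bounded_linear (\<lambda>v. \<integral>z. D z v \<partial>M)"
    proof (rule bounded_linear_intro)
      fix v w
      \<comment> \<open>\<open>D z\<close> is known to be linear only for almost every
        \<open>z\<close>.\<close>
      have "(\<integral>z. D z (v + w) \<partial>M) = (\<integral>z. D z v + D z w \<partial>M)"
        using diff meas
        by (intro integral_cong_AE)
           (auto elim!: eventually_mono simp: linear_add[OF has_derivative_linear])
      then show "(\<integral>z. D z (v + w) \<partial>M) = (\<integral>z. D z v \<partial>M) + (\<integral>z. D z w \<partial>M)"
        by (simp add: int_D)
    next
      fix c :: real and v
      have "(\<integral>z. D z (c *\<^sub>R v) \<partial>M) = (\<integral>z. c *\<^sub>R D z v \<partial>M)"
        using diff meas
        by (intro integral_cong_AE)
           (auto elim!: eventually_mono simp: linear_cmul[OF has_derivative_linear])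
      then show "(\<integral>z. D z (c *\<^sub>R v) \<partial>M) = c *\<^sub>R (\<integral>z. D z v \<partial>M)"
        by simp
    next
      fix v
      have "norm (\<integral>z. D z v \<partial>M) \<le> (\<integral>z. norm v * h z \<partial>M)"
      proof (rule order_trans[OF integral_norm_bound integral_mono_AE])
        show "AE z in M. norm (D z v) \<le> norm v * h z"
          using bound by eventually_elim (simp add: mult.commute)
      qed (use int_D[of v] h in simp_all)
      then show "norm (\<integral>z. D z v \<partial>M) \<le> norm v * (\<integral>z. h z \<partial>M)"
        by simp
    qed
    have "((\<lambda>v. \<integral>z. (f (x0 + v) z - f x0 z - D z v) / norm v \<partial>M) \<longlongrightarrow> (\<integral>z. 0 \<partial>M)) (at 0)"
      unfolding tendsto_at_iff_sequentially
    proof (intro allI impI)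
      fix X :: "nat \<Rightarrow> 'a"
      assume X: "\<forall>i. X i \<in> UNIV - {0}" "X \<longlonglongrightarrow> 0"
      have "\<forall>\<^sub>F n in sequentially. norm (X n) < r"
        using X(2) r tendsto_norm_zero order_tendstoD(2) by blast
      then obtain N where N: "\<And>n. N \<le> n \<Longrightarrow> norm (X n) < r"
        by (auto simp: eventually_sequentially)
      \<comment> \<open>Shifting by \<open>N\<close> drops the terms outside the ball, where neither
        integrability nor the majorant is available.\<close>
      let ?R = "\<lambda>n z. (f (x0 + X (n + N)) z - f x0 z - D z (X (n + N))) / norm (X (n + N))"
      have "(\<lambda>n. \<integral>z. ?R n z \<partial>M) \<longlonglongrightarrow> (\<integral>z. 0 \<partial>M)"
      proof (rule integral_dominated_convergence)
        show "integrable M (\<lambda>z. 2 * h z)"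
          using h by simp
        show "?R n \<in> borel_measurable M" for n
          using int[of "x0 + X (n + N)"] int[of x0] N[of "n + N"] r meas
          by (intro borel_measurable_divide borel_measurable_diff borel_measurable_const
              borel_measurable_integrable) (auto simp: dist_norm int_D)
        show "AE z in M. (\<lambda>n. ?R n z) \<longlonglongrightarrow> 0"
          using diff
        proof eventually_elim
          case (elim z)
          have "((\<lambda>v. norm (f (x0 + v) z - f x0 z - D z v) / norm v) \<longlongrightarrow> 0) (at 0)"
            using elim by (simp add: has_derivative_at)
          then have "((\<lambda>v. norm (f (x0 + v) z - f x0 z - D z v) / norm v) \<circ> X) \<longlonglongrightarrow> 0"
            using X unfolding tendsto_at_iff_sequentially by blast
          then have "(\<lambda>n. norm (?R n z)) \<longlonglongrightarrow> 0"
            using LIMSEQ_ignore_initial_segment[where k = N] by (fastforce simp: o_def)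
          then show ?case
            by (rule tendsto_norm_zero_cancel)
        qed
        show "AE z in M. norm (?R n z) \<le> 2 * h z" for n
          using bound lip
        proof eventually_elim
          case (elim z)
          have "\<bar>f (x0 + X (n + N)) z - f x0 z\<bar> \<le> h z * norm (X (n + N))"
            using elim(2) N[of "n + N"] by (auto simp: dist_norm dest: bspec[of _ _ "x0 + X (n + N)"])
          then have "\<bar>f (x0 + X (n + N)) z - f x0 z - D z (X (n + N))\<bar> \<le> 2 * h z * norm (X (n + N))"
            using elim(1)[rule_format, of "X (n + N)"] by linarith
          then show ?case
            using X(1) by (simp add: divide_le_eq)
        qed
      qed simp
      then show "((\<lambda>v. \<integral>z. (f (x0 + v) z - f x0 z - D z v) / norm v \<partial>M) \<circ> X) \<longlonglongrightarrow> (\<integral>z. 0 \<partial>M)"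
        unfolding o_def by (rule LIMSEQ_offset)
    qed
    then have "((\<lambda>v. norm (\<integral>z. (f (x0 + v) z - f x0 z - D z v) / norm v \<partial>M)) \<longlongrightarrow> 0) (at 0)"
      by (intro tendsto_norm_zero) simp
    then show "(\<lambda>v. norm ((\<integral>z. f (x0 + v) z \<partial>M) - (\<integral>z. f x0 z \<partial>M) - (\<integral>z. D z v \<partial>M)) / norm v)
        \<midarrow>0\<rightarrow> 0"
    proof (rule Lim_transform_eventually)
      have "\<forall>\<^sub>F v in at 0. norm (v::'a) < r"
        using r by (auto simp: eventually_at intro!: exI[of _ r])
      then show "\<forall>\<^sub>F v in at 0. norm (\<integral>z. (f (x0 + v) z - f x0 z - D z v) / norm v \<partial>M) =
          norm ((\<integral>z. f (x0 + v) z \<partial>M) - (\<integral>z. f x0 z \<partial>M) - (\<integral>z. D z v \<partial>M)) / norm v"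
      proof eventually_elim
        case (elim v)
        have "integrable M (f (x0 + v))" "integrable M (f x0)"
          using elim r by (auto intro!: int simp: dist_norm)
        then show ?case
          by (simp add: int_D)
      qed
    qed
  qed
qed

section \<open>The standard Gaussian measure\<close>

lemma gauss_density_pos: "0 < gauss_density \<mu> \<sigma> x" if "\<sigma> \<noteq> 0"
  using that by (simp add: gauss_density_def)

lemma gauss_density_nonneg: "0 \<le> gauss_density \<mu> \<sigma> x"
  by (simp add: gauss_density_def)

lemma borel_measurable_gauss_density [measurable]:
  "(\<lambda>(\<mu>, x). gauss_density \<mu> \<sigma> x) \<in> borel_measurable (borel \<Otimes>\<^sub>M borel)"
  unfolding gauss_density_def by measurable

lemma borel_measurable_gauss_density' [measurable (raw)]:
  assumes "f \<in> borel_measurable M" "h \<in> borel_measurable M"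
  shows "(\<lambda>z. gauss_density (f z) \<sigma> (h z)) \<in> borel_measurable M"
  using measurable_compose[OF measurable_Pair[OF assms] borel_measurable_gauss_density] by simp

lemma gauss_density_eq_prod:
  fixes \<mu> x :: "real^'n"
  assumes "0 < \<sigma>"
  shows "gauss_density \<mu> \<sigma> x = (\<Prod>b\<in>Basis. normal_density (\<mu> \<bullet> b) \<sigma> (x \<bullet> b))"
proof -
  have "(norm (x - \<mu>))\<^sup>2 = (\<Sum>b\<in>Basis. (x \<bullet> b - \<mu> \<bullet> b)\<^sup>2)"
    unfolding power2_norm_eq_inner by (subst euclidean_inner) (simp add: power2_eq_square inner_diff_left)
  then have "exp (- (norm (x - \<mu>))\<^sup>2 / (2 * \<sigma>\<^sup>2)) = (\<Prod>b\<in>Basis. exp (- (x \<bullet> b - \<mu> \<bullet> b)\<^sup>2 / (2 * \<sigma>\<^sup>2)))"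
    by (simp add: exp_sum[symmetric] sum_negf sum_divide_distrib)
  then show ?thesis
    by (simp add: gauss_density_def normal_density_def prod_dividef)
qed

lemma nn_integral_gauss_density:
  fixes \<mu> :: "real^'n"
  assumes "0 < \<sigma>"
  shows "(\<integral>\<^sup>+x. ennreal (gauss_density \<mu> \<sigma> x) \<partial>lborel) = 1"
proof -
  have 1: "(\<integral>\<^sup>+x. ennreal (normal_density m \<sigma> x) \<partial>lborel) = 1" for m
    using prob_space.emeasure_space_1[OF prob_space_normal_density[OF assms, of m]]
    by (simp add: emeasure_density)
  have "(\<integral>\<^sup>+x. ennreal (gauss_density \<mu> \<sigma> x) \<partial>lborel)
    = (\<integral>\<^sup>+x. (\<Prod>b\<in>Basis. ennreal (normal_density (\<mu> \<bullet> b) \<sigma> (x \<bullet> b))) \<partial>lborel)"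
    using assms by (simp add: gauss_density_eq_prod prod_ennreal)
  also have "\<dots> = (\<Prod>b\<in>Basis. \<integral>\<^sup>+x. ennreal (normal_density (\<mu> \<bullet> b) \<sigma> x) \<partial>lborel)"
    by (rule nn_integral_lborel_prod) auto
  also have "\<dots> = 1"
    by (simp add: 1)
  finally show ?thesis .
qed

text \<open>Completing before or after taking the density gives the same measure because the
  Gaussian density vanishes nowhere. Borel integrands can thus be computed over
  \<open>lborel\<close>, while completeness remains available.\<close>

lemma std_gaussian_eq_completion:
  "std_gaussian = completion (density lborel (\<lambda>z. ennreal (gauss_density 0 1 z)))"
  unfolding std_gaussian_def
  by (rule completion_density_eq[symmetric]) (auto intro!: AE_I2 gauss_density_pos)

lemma space_std_gaussian [simp]: "space std_gaussian = UNIV"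
  by (simp add: std_gaussian_def)

lemma sets_std_gaussian: "sets std_gaussian = sets lebesgue"
  by (simp add: std_gaussian_def)

lemma borel_measurable_std_gaussianI:
  assumes f: "f \<in> borel \<rightarrow>\<^sub>M N"
  shows "f \<in> std_gaussian \<rightarrow>\<^sub>M N"
proof -
  have "f \<in> lborel \<rightarrow>\<^sub>M N"
    using f by simp
  then show ?thesis
    unfolding measurable_cong_sets[OF sets_std_gaussian refl] by (rule measurable_completion)
qed

lemma measurable_ident_std_gaussian: "(\<lambda>z. z) \<in> std_gaussian \<rightarrow>\<^sub>M borel"
  by (rule borel_measurable_std_gaussianI) simp

lemma nn_integral_std_gaussian:
  assumes f[measurable]: "f \<in> borel_measurable borel"
  shows "(\<integral>\<^sup>+z. f z \<partial>std_gaussian) = (\<integral>\<^sup>+z. ennreal (gauss_density 0 1 z) * f z \<partial>lborel)"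
  by (simp add: std_gaussian_eq_completion nn_integral_completion nn_integral_density)

lemma prob_space_std_gaussian: "prob_space (std_gaussian :: (real^'n) measure)"
proof
  have "emeasure (std_gaussian :: (real^'n) measure) UNIV = (\<integral>\<^sup>+z. 1 \<partial>(std_gaussian :: (real^'n) measure))"
    by simp
  also have "\<dots> = 1"
    by (subst nn_integral_std_gaussian) (simp_all add: nn_integral_gauss_density)
  finally show "emeasure (std_gaussian :: (real^'n) measure) (space std_gaussian) = 1"
    by simp
qed

text \<open>The Jacobian factor of the affine substitution cancels against the normalisations.
  Negative \<open>c\<close> is allowed, which yields the symmetry of the Gaussian.\<close>

lemma nn_integral_std_gaussian_affine:
  fixes m :: "real^'n"
  assumes c: "c \<noteq> 0" and f[measurable]: "f \<in> borel_measurable borel"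
  shows "(\<integral>\<^sup>+\<epsilon>. f (m + c *\<^sub>R \<epsilon>) \<partial>std_gaussian) = (\<integral>\<^sup>+x. ennreal (gauss_density m c x) * f x \<partial>lborel)"
proof -
  have "\<bar>c\<bar> ^ CARD('n) * gauss_density m c (m + c *\<^sub>R \<epsilon>) = gauss_density 0 1 \<epsilon>" for \<epsilon> :: "real^'n"
    using c by (simp add: gauss_density_def real_sqrt_mult power_mult_distrib)
  then have eq: "ennreal (\<bar>c\<bar> ^ CARD('n)) * ennreal (gauss_density m c (m + c *\<^sub>R \<epsilon>)) = ennreal (gauss_density 0 1 \<epsilon>)"
    for \<epsilon> :: "real^'n"
    by (subst ennreal_mult[symmetric]) (simp_all add: gauss_density_nonneg)
  have "(\<integral>\<^sup>+x. ennreal (gauss_density m c x) * f x \<partial>lborel) =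
     (\<integral>\<^sup>+\<epsilon>. ennreal (\<bar>c\<bar> ^ CARD('n)) * (ennreal (gauss_density m c (m + c *\<^sub>R \<epsilon>)) * f (m + c *\<^sub>R \<epsilon>)) \<partial>lborel)"
    by (subst lborel_affine[OF c, of m])
       (simp add: nn_integral_density nn_integral_distr)
  also have "\<dots> = (\<integral>\<^sup>+\<epsilon>. ennreal (gauss_density 0 1 \<epsilon>) * f (m + c *\<^sub>R \<epsilon>) \<partial>lborel)"
    by (simp add: eq mult.assoc[symmetric])
  finally show ?thesis
    by (simp add: nn_integral_std_gaussian)
qed

text \<open>The right side is a pushforward by the identity because \<open>std_gaussian\<close>
  lives on the Lebesgue sets and the comparison is made on the Borel sets.\<close>

lemma distr_std_gaussian_uminus:
  "distr std_gaussian borel uminus = distr (std_gaussian :: (real^'n) measure) borel (\<lambda>z. z)"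
proof (rule measure_eqI)
  fix A :: "(real^'n) set"
  assume "A \<in> sets (distr std_gaussian borel uminus)"
  then have A[measurable]: "A \<in> sets borel"
    by simp
  \<comment> \<open>Both sides are affine images, with scales -1 and 1; \<open>gauss_density\<close>
    sees the scale only through its square.\<close>
  have "(\<integral>\<^sup>+z. indicator A (0 + (-1) *\<^sub>R z) \<partial>std_gaussian) = (\<integral>\<^sup>+z. indicator A (0 + 1 *\<^sub>R z) \<partial>std_gaussian)"
    by (simp only: nn_integral_std_gaussian_affine A borel_measurable_indicator)
      (simp add: nn_integral_std_gaussian_affine gauss_density_def del: add_0)
  then have "(\<integral>\<^sup>+z. indicator A z \<partial>distr std_gaussian borel uminus)
      = (\<integral>\<^sup>+z. indicator A z \<partial>distr std_gaussian borel (\<lambda>z. z))"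
    by (simp add: nn_integral_distr borel_measurable_std_gaussianI del: nn_integral_indicator)
  then show "emeasure (distr std_gaussian borel uminus) A = emeasure (distr std_gaussian borel (\<lambda>z. z)) A"
    by simp
qed simp

lemma integral_std_gaussian_inner: "(\<integral>\<epsilon>. w \<bullet> \<epsilon> \<partial>std_gaussian) = (0::real)"
proof -
  have "(\<integral>\<epsilon>. w \<bullet> \<epsilon> \<partial>distr std_gaussian borel uminus) = (\<integral>\<epsilon>. w \<bullet> \<epsilon> \<partial>distr std_gaussian borel (\<lambda>z. z))"
    by (simp only: distr_std_gaussian_uminus)
  then have "(\<integral>\<epsilon>. - (w \<bullet> \<epsilon>) \<partial>std_gaussian) = (\<integral>\<epsilon>. w \<bullet> \<epsilon> \<partial>std_gaussian)"
    by (simp add: integral_distr borel_measurable_std_gaussianI)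
  then show ?thesis
    by simp
qed

lemma integrable_std_gaussian_norm_sq:
  "integrable (std_gaussian :: (real^'n) measure) (\<lambda>\<epsilon>. (norm \<epsilon>)\<^sup>2)"
proof (rule integrableI_bounded)
  \<comment> \<open>Half of the exponent absorbs the squared norm, leaving a Gaussian of variance 2.
    The factor 4 undoes the scaling in \<open>s\<close>, and the power of \<open>sqrt 2\<close> is
    the ratio of the normalisations.\<close>
  let ?C = "4 * sqrt 2 ^ CARD('n)"
  have le: "gauss_density 0 1 z * (norm z)\<^sup>2 \<le> ?C * gauss_density 0 (sqrt 2) z" for z :: "real^'n"
  proof -
    define s where "s = (norm z)\<^sup>2 / 4"
    have "s \<le> exp s"
      using exp_ge_add_one_self[of s] by linarith
    then have "exp (- 2 * s) * s \<le> exp (- 2 * s) * exp s"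
      by (rule mult_left_mono) simp
    also have "\<dots> = exp (- s)"
      by (simp add: exp_add[symmetric])
    finally have "exp (- (norm z)\<^sup>2 / 2) * (norm z)\<^sup>2 \<le> 4 * exp (- (norm z)\<^sup>2 / 4)"
      by (simp add: s_def)
    moreover have "?C * gauss_density 0 (sqrt 2) z = 4 * exp (- (norm z)\<^sup>2 / 4) / sqrt (2 * pi) ^ CARD('n)"
    proof -
      have "sqrt (2 * pi * (sqrt 2)\<^sup>2) = sqrt 2 * sqrt (2 * pi)"
        by (simp add: real_sqrt_mult)
      then have "sqrt (2 * pi * (sqrt 2)\<^sup>2) ^ CARD('n) = sqrt 2 ^ CARD('n) * sqrt (2 * pi) ^ CARD('n)"
        by (simp only: power_mult_distrib)
      then show ?thesis
        by (simp add: gauss_density_def)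
    qed
    ultimately show ?thesis
      by (simp add: gauss_density_def divide_right_mono)
  qed
  have "(\<integral>\<^sup>+z. ennreal (norm ((norm z)\<^sup>2)) \<partial>(std_gaussian :: (real^'n) measure))
      = (\<integral>\<^sup>+z. ennreal (gauss_density 0 1 (z :: real^'n)) * ennreal ((norm z)\<^sup>2) \<partial>lborel)"
    by (simp add: nn_integral_std_gaussian)
  also have "\<dots> \<le> (\<integral>\<^sup>+z. ennreal ?C * ennreal (gauss_density 0 (sqrt 2) (z :: real^'n)) \<partial>lborel)"
    using le by (intro nn_integral_mono) (simp add: ennreal_mult'[symmetric] gauss_density_nonneg ennreal_leI)
  also have "\<dots> = ennreal ?C"
    by (simp add: nn_integral_cmult nn_integral_gauss_density)
  also have "\<dots> < \<infinity>"
    by simp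
  finally show "(\<integral>\<^sup>+z. ennreal (norm ((norm z)\<^sup>2)) \<partial>(std_gaussian :: (real^'n) measure)) < \<infinity>" .
qed (rule borel_measurable_std_gaussianI, simp)

lemma complete_measure_std_gaussian: "complete_measure std_gaussian"
  unfolding std_gaussian_eq_completion by (rule completion.complete_measure_axioms)

text \<open>Meant for derivatives that exist almost everywhere and take a default value
  elsewhere.\<close>

lemma (in complete_measure) borel_measurable_AE_eq:
  fixes f g :: "'a \<Rightarrow> 'b::topological_space"
  assumes f: "f \<in> borel_measurable M" and eq: "AE x in M. f x = g x"
  shows "g \<in> borel_measurable M"
proof (rule measurableI)
  fix A :: "'b set"
  assume "A \<in> sets borel"
  then have "f -` A \<inter> space M \<in> sets M"
    using f by (rule measurable_sets[rotated])
  then show "g -` A \<inter> space M \<in> sets M"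
    by (rule in_sets_AE[rotated]) (use eq in \<open>auto elim!: eventually_mono\<close>)
qed simp

section \<open>Gaussian smoothing of a probability measure\<close>

lemma gauss_density_eq_exp:
  "gauss_density \<mu> \<sigma> x = gauss_density 0 \<sigma> (0 :: real^'n) * exp (- (norm (x - \<mu>))\<^sup>2 / (2 * \<sigma>\<^sup>2))"
  for x :: "real^'n"
  by (simp add: gauss_density_def)

lemma gauss_density_le: "gauss_density \<mu> \<sigma> x \<le> gauss_density 0 \<sigma> (0 :: real^'n)" for x :: "real^'n"
  by (subst gauss_density_eq_exp) (auto intro!: mult_left_le simp: gauss_density_nonneg)

text \<open>The threshold is \<open>2 m\<close> because beyond it half of the exponent absorbs the factor
  \<open>norm (x - \<mu>)\<close> and the other half still decays like the lower bound for a smoothed density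
  (\<open>p_lower_bound\<close>), so the quotient stays bounded.\<close>

lemma gauss_density_mult_norm_le:
  fixes x :: "real^'n"
  assumes \<sigma>: "0 < \<sigma>" and m: "0 \<le> m"
  shows "gauss_density \<mu> \<sigma> x * norm (x - \<mu>)
    \<le> 2 * m * gauss_density \<mu> \<sigma> x + 2 * \<sigma> * (gauss_density 0 \<sigma> (0 :: real^'n) * exp (- m\<^sup>2 / (2 * \<sigma>\<^sup>2)))"
proof (cases "norm (x - \<mu>) \<le> 2 * m")
  case True
  then have "gauss_density \<mu> \<sigma> x * norm (x - \<mu>) \<le> gauss_density \<mu> \<sigma> x * (2 * m)"
    by (intro mult_left_mono gauss_density_nonneg)
  moreover have "0 \<le> 2 * \<sigma> * (gauss_density 0 \<sigma> (0 :: real^'n) * exp (- m\<^sup>2 / (2 * \<sigma>\<^sup>2)))"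
    using \<sigma> by (simp add: gauss_density_nonneg)
  ultimately show ?thesis
    by (simp add: mult.commute)
next
  case False
  \<comment> \<open>In this scale the exponent is \<open>- 2 * s\<^sup>2\<close>: one copy of
    \<open>s\<^sup>2\<close> absorbs the factor \<open>s\<close>, and the other is compared with the
    threshold.\<close>
  define s where "s = norm (x - \<mu>) / (2 * \<sigma>)"
  have u: "norm (x - \<mu>) = 2 * \<sigma> * s"
    using \<sigma> by (simp add: s_def)
  have s: "m / \<sigma> \<le> s"
    using False \<sigma> by (simp add: s_def field_simps)
  have "s \<le> 1 + s\<^sup>2"
    using sum_power2_ge_zero[of "s - 1" s] zero_le_power2[of "s - 1"] by (simp add: power2_eq_square algebra_simps)
  also have "\<dots> \<le> exp (s\<^sup>2)"
    by (rule exp_ge_add_one_self)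
  finally have "exp (- 2 * s\<^sup>2) * s \<le> exp (- 2 * s\<^sup>2) * exp (s\<^sup>2)"
    by (rule mult_left_mono) simp
  also have "\<dots> = exp (- s\<^sup>2)"
    by (simp flip: exp_add)
  also have "\<dots> \<le> exp (- (m / \<sigma>)\<^sup>2)"
    using s m \<sigma> by (simp add: power_mono)
  also have "\<dots> \<le> exp (- m\<^sup>2 / (2 * \<sigma>\<^sup>2))"
    using \<sigma> by (simp add: power_divide divide_simps)
  finally have "gauss_density 0 \<sigma> (0 :: real^'n) * (2 * \<sigma>) * (exp (- 2 * s\<^sup>2) * s)
      \<le> gauss_density 0 \<sigma> (0 :: real^'n) * (2 * \<sigma>) * exp (- m\<^sup>2 / (2 * \<sigma>\<^sup>2))"
    using \<sigma> by (intro mult_left_mono) (auto simp: gauss_density_nonneg)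
  moreover have "gauss_density \<mu> \<sigma> x = gauss_density 0 \<sigma> (0 :: real^'n) * exp (- 2 * s\<^sup>2)"
    using \<sigma> by (subst gauss_density_eq_exp) (simp add: u power_mult_distrib)
  ultimately have "gauss_density \<mu> \<sigma> x * norm (x - \<mu>) \<le> gauss_density 0 \<sigma> (0 :: real^'n) * (2 * \<sigma>) * exp (- m\<^sup>2 / (2 * \<sigma>\<^sup>2))"
    unfolding u by (simp only: ac_simps)
  moreover have "0 \<le> 2 * m * gauss_density \<mu> \<sigma> x"
    using m by (simp add: gauss_density_nonneg)
  ultimately show ?thesis
    by (simp only: ac_simps add_increasing)
qed

lemma has_derivative_gauss_density:
  fixes x :: "real^'n"
  shows "(gauss_density \<mu> \<sigma> has_derivative
    (\<lambda>v. v \<bullet> ((gauss_density \<mu> \<sigma> x / \<sigma>\<^sup>2) *\<^sub>R (\<mu> - x)))) (at x)"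
proof -
  define k where "k = 1 / (2 * \<sigma>\<^sup>2)"
  have eq: "gauss_density \<mu> \<sigma> = (\<lambda>x :: real^'n. gauss_density 0 \<sigma> (0 :: real^'n) * exp (- k * ((x - \<mu>) \<bullet> (x - \<mu>))))"
    by (rule ext, subst gauss_density_eq_exp) (simp add: power2_norm_eq_inner k_def)
  have "gauss_density \<mu> \<sigma> x / \<sigma>\<^sup>2 = 2 * k * gauss_density \<mu> \<sigma> x"
    by (simp add: k_def)
  then show ?thesis
    unfolding eq
    by (auto intro!: derivative_eq_intros ext simp: inner_diff_left inner_diff_right inner_commute algebra_simps)
qed

text \<open>At threshold 0 the preceding bound controls the gradient uniformly in \<open>x\<close>
  and \<mu>. A constant therefore dominates when the kernel is differentiated under any probability
  measure.\<close>

lemma gauss_density_lipschitz: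
  fixes x y :: "real^'n"
  assumes \<sigma>: "0 < \<sigma>"
  shows "\<bar>gauss_density \<mu> \<sigma> x - gauss_density \<mu> \<sigma> y\<bar> \<le> 2 * gauss_density 0 \<sigma> (0 :: real^'n) / \<sigma> * norm (x - y)"
proof -
  have "norm (gauss_density \<mu> \<sigma> x - gauss_density \<mu> \<sigma> y) \<le> 2 * gauss_density 0 \<sigma> (0 :: real^'n) / \<sigma> * norm (x - y)"
  proof (rule differentiable_bound[OF convex_UNIV])
    fix z :: "real^'n"
    show "(gauss_density \<mu> \<sigma> has_derivative (\<lambda>v. v \<bullet> ((gauss_density \<mu> \<sigma> z / \<sigma>\<^sup>2) *\<^sub>R (\<mu> - z)))) (at z)"
      by (rule has_derivative_gauss_density)
    have "norm ((gauss_density \<mu> \<sigma> z / \<sigma>\<^sup>2) *\<^sub>R (\<mu> - z)) = gauss_density \<mu> \<sigma> z * norm (z - \<mu>) / \<sigma>\<^sup>2"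
      by (simp add: gauss_density_nonneg norm_minus_commute)
    also have "\<dots> \<le> 2 * \<sigma> * gauss_density 0 \<sigma> (0 :: real^'n) / \<sigma>\<^sup>2"
      using gauss_density_mult_norm_le[OF \<sigma>, of 0 \<mu> z] by (intro divide_right_mono) simp_all
    also have "\<dots> = 2 * gauss_density 0 \<sigma> (0 :: real^'n) / \<sigma>"
      using \<sigma> by (simp add: power2_eq_square)
    finally have "norm v * norm ((gauss_density \<mu> \<sigma> z / \<sigma>\<^sup>2) *\<^sub>R (\<mu> - z)) \<le> norm v * (2 * gauss_density 0 \<sigma> (0 :: real^'n) / \<sigma>)" for v :: "real^'n"
      by (rule mult_left_mono) simp
    then have "norm (v \<bullet> ((gauss_density \<mu> \<sigma> z / \<sigma>\<^sup>2) *\<^sub>R (\<mu> - z))) \<le> 2 * gauss_density 0 \<sigma> (0 :: real^'n) / \<sigma> * norm v" for v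
      unfolding real_norm_def mult.commute[of _ "norm v"] by (rule order_trans[OF Cauchy_Schwarz_ineq2])
    then show "onorm (\<lambda>v. v \<bullet> ((gauss_density \<mu> \<sigma> z / \<sigma>\<^sup>2) *\<^sub>R (\<mu> - z))) \<le> 2 * gauss_density 0 \<sigma> (0 :: real^'n) / \<sigma>"
      by (rule onorm_le)
  qed auto
  then show ?thesis
    by simp
qed

lemma grad_eqI:
  fixes f :: "real^'n \<Rightarrow> real"
  assumes "(f has_derivative (\<lambda>v. v \<bullet> S)) (at x)"
  shows "grad f x = S"
  by (simp add: grad_def frechet_derivative_at[OF assms, symmetric] vec_eq_iff inner_axis')

text \<open>Model law and target law are treated alike. Neither a density nor a moment of
  \<open>P\<close> enters, so singular model laws are covered.\<close>

locale gauss_smoothing = prob_space P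
  for P :: "(real^'n) measure" and \<alpha> \<sigma> :: real +
  assumes sets_P [measurable_cong]: "sets P = sets borel"
    and sigma_pos: "0 < \<sigma>"
begin

abbreviation p :: "real^'n \<Rightarrow> real" where "p \<equiv> convolved_density \<alpha> \<sigma> P"

definition p_grad :: "real^'n \<Rightarrow> real^'n" where
  "p_grad x = (\<integral>y. (gauss_density (\<alpha> *\<^sub>R y) \<sigma> x / \<sigma>\<^sup>2) *\<^sub>R (\<alpha> *\<^sub>R y - x) \<partial>P)"

lemma borel_measurable_kernel: "(\<lambda>y. gauss_density (\<alpha> *\<^sub>R y) \<sigma> x) \<in> borel_measurable P"
  by measurable

lemma integrable_kernel: "integrable P (\<lambda>y. gauss_density (\<alpha> *\<^sub>R y) \<sigma> x)"
  by (rule integrable_const_bound[where B = "gauss_density 0 \<sigma> (0 :: real^'n)"])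
    (auto intro!: AE_I2 borel_measurable_kernel simp: gauss_density_le gauss_density_nonneg)

text \<open>The threshold stays free: 0 gives integrability of the kernel gradient, and a value
  growing with \<open>norm x\<close> gives the growth of the score.\<close>

lemma kernel_grad_norm_le:
  fixes x y :: "real^'n"
  assumes "0 \<le> m"
  shows "norm ((gauss_density (\<alpha> *\<^sub>R y) \<sigma> x / \<sigma>\<^sup>2) *\<^sub>R (\<alpha> *\<^sub>R y - x))
    \<le> (2 * m * gauss_density (\<alpha> *\<^sub>R y) \<sigma> x + 2 * \<sigma> * (gauss_density 0 \<sigma> (0 :: real^'n) * exp (- m\<^sup>2 / (2 * \<sigma>\<^sup>2)))) / \<sigma>\<^sup>2"
  using divide_right_mono[OF gauss_density_mult_norm_le[OF sigma_pos assms, of "\<alpha> *\<^sub>R y" x], of "\<sigma>\<^sup>2"]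
  by (simp add: gauss_density_nonneg norm_minus_commute)

lemma integrable_kernel_grad:
  "integrable P (\<lambda>y. (gauss_density (\<alpha> *\<^sub>R y) \<sigma> x / \<sigma>\<^sup>2) *\<^sub>R (\<alpha> *\<^sub>R y - x))"
proof (rule integrable_const_bound)
  show "AE y in P. norm ((gauss_density (\<alpha> *\<^sub>R y) \<sigma> x / \<sigma>\<^sup>2) *\<^sub>R (\<alpha> *\<^sub>R y - x)) \<le> 2 * \<sigma> * gauss_density 0 \<sigma> (0 :: real^'n) / \<sigma>\<^sup>2"
    using kernel_grad_norm_le[of 0] by (intro AE_I2) simp
qed measurable

lemma borel_measurable_p [measurable]: "p \<in> borel_measurable borel"
  unfolding convolved_density_def by measurable

lemma borel_measurable_p_grad [measurable]: "p_grad \<in> borel_measurable borel"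
  unfolding p_grad_def by measurable

text \<open>The sets where \<open>norm (\<alpha> *\<^sub>R y)\<close> is at most \<open>n\<close>
  exhaust the space, so one of them has positive mass \<beta>. For \<open>y\<close> in it the centre
  lies within \<open>norm x + R\<close> of \<open>x\<close>, which bounds the kernel from
  below.\<close>

lemma p_lower_bound:
  obtains R \<beta> where "0 \<le> R" "0 < \<beta>"
    "\<And>x. \<beta> * (gauss_density 0 \<sigma> (0 :: real^'n) * exp (- (norm x + R)\<^sup>2 / (2 * \<sigma>\<^sup>2))) \<le> p x"
proof -
  have "\<exists>n::nat. prob {y. norm (\<alpha> *\<^sub>R y) \<le> real n} \<noteq> 0"
  proof (rule ccontr)
    assume "\<not> ?thesis"
    then have "AE y in P. \<not> norm (\<alpha> *\<^sub>R y) \<le> real n" for n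
      by (subst AE_iff_measurable[OF _ refl])
        (auto simp: emeasure_eq_measure sets_eq_imp_space_eq[OF sets_P])
    then have "AE y in P. \<forall>n::nat. \<not> norm (\<alpha> *\<^sub>R y) \<le> real n"
      by (simp add: AE_all_countable)
    then have "AE y in P. False"
      by (rule eventually_mono) (use real_arch_simple in blast)
    then show False
      by simp
  qed
  then obtain n where n: "prob {y. norm (\<alpha> *\<^sub>R y) \<le> real n} \<noteq> 0"
    by blast
  let ?A = "{y. norm (\<alpha> *\<^sub>R y) \<le> real n}"
  have A [measurable]: "?A \<in> sets P"
    by (simp add: sets_P)
  show thesis
  proof
    show "0 \<le> real n" "0 < prob ?A"
      using n by (auto simp: zero_less_measure_iff)
    fix x :: "real^'n"
    let ?e = "gauss_density 0 \<sigma> (0 :: real^'n) * exp (- (norm x + real n)\<^sup>2 / (2 * \<sigma>\<^sup>2))"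
    have "(\<integral>y. indicator ?A y * ?e \<partial>P) \<le> p x"
      unfolding convolved_density_def
    proof (rule integral_mono)
      show "integrable P (\<lambda>y. indicator ?A y * ?e)"
        by (intro integrable_mult_left integrable_real_indicator) (auto simp: emeasure_eq_measure)
      show "indicator ?A y * ?e \<le> gauss_density (\<alpha> *\<^sub>R y) \<sigma> x" for y
      proof (cases "y \<in> ?A")
        case True
        have "norm (x - \<alpha> *\<^sub>R y) \<le> norm x + real n"
          using True norm_triangle_ineq4[of x "\<alpha> *\<^sub>R y"] by simp
        then have "(norm (x - \<alpha> *\<^sub>R y))\<^sup>2 / (2 * \<sigma>\<^sup>2) \<le> (norm x + real n)\<^sup>2 / (2 * \<sigma>\<^sup>2)"
          by (intro divide_right_mono power_mono) auto
        then show ?thesis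
          using True by (subst gauss_density_eq_exp) (auto intro!: mult_left_mono gauss_density_nonneg)
      qed (simp add: gauss_density_nonneg)
    qed (rule integrable_kernel)
    then show "prob ?A * ?e \<le> p x"
      using A by (simp add: sets_eq_imp_space_eq[OF sets_P])
  qed
qed

lemma p_pos: "0 < p x"
proof -
  obtain R \<beta> where "0 < \<beta>" "\<beta> * (gauss_density 0 \<sigma> (0 :: real^'n) * exp (- (norm x + R)\<^sup>2 / (2 * \<sigma>\<^sup>2))) \<le> p x"
    by (rule p_lower_bound) blast
  moreover have "0 < \<beta> * (gauss_density 0 \<sigma> (0 :: real^'n) * exp (- (norm x + R)\<^sup>2 / (2 * \<sigma>\<^sup>2)))"
    using \<open>0 < \<beta>\<close> sigma_pos by (simp add: gauss_density_pos)
  ultimately show ?thesis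
    by linarith
qed

lemma has_derivative_p: "(p has_derivative (\<lambda>v. v \<bullet> p_grad x)) (at x)"
proof -
  have "((\<lambda>x. \<integral>y. gauss_density (\<alpha> *\<^sub>R y) \<sigma> x \<partial>P) has_derivative
      (\<lambda>v. \<integral>y. v \<bullet> ((gauss_density (\<alpha> *\<^sub>R y) \<sigma> x / \<sigma>\<^sup>2) *\<^sub>R (\<alpha> *\<^sub>R y - x)) \<partial>P)) (at x)"
  \<comment> \<open>The Lipschitz bound is global, so the radius 1 is arbitrary.\<close>
  proof (rule has_derivative_integral[where h = "\<lambda>_. 2 * gauss_density 0 \<sigma> (0 :: real^'n) / \<sigma>" and r = 1])
    show "AE y in P. \<forall>z\<in>ball x 1. \<bar>gauss_density (\<alpha> *\<^sub>R y) \<sigma> z - gauss_density (\<alpha> *\<^sub>R y) \<sigma> x\<bar>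
        \<le> 2 * gauss_density 0 \<sigma> (0 :: real^'n) / \<sigma> * norm (z - x)"
      using gauss_density_lipschitz[OF sigma_pos] by (intro AE_I2) blast
    show "AE y in P. (gauss_density (\<alpha> *\<^sub>R y) \<sigma> has_derivative
        (\<lambda>v. v \<bullet> ((gauss_density (\<alpha> *\<^sub>R y) \<sigma> x / \<sigma>\<^sup>2) *\<^sub>R (\<alpha> *\<^sub>R y - x)))) (at x)"
      by (intro AE_I2 has_derivative_gauss_density)
    show "(\<lambda>y. v \<bullet> ((gauss_density (\<alpha> *\<^sub>R y) \<sigma> x / \<sigma>\<^sup>2) *\<^sub>R (\<alpha> *\<^sub>R y - x))) \<in> borel_measurable P" for v
      by (intro borel_measurable_inner borel_measurable_const borel_measurable_integrable[OF integrable_kernel_grad])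
  qed (auto intro: integrable_kernel)
  then show ?thesis
    by (simp add: convolved_density_def[abs_def] p_grad_def integrable_kernel_grad del: inner_scaleR_right)
qed

lemma has_derivative_ln_p: "((\<lambda>x. ln (p x)) has_derivative (\<lambda>v. v \<bullet> (p_grad x /\<^sub>R p x))) (at x)"
  using p_pos[of x]
  by (auto intro!: derivative_eq_intros has_derivative_p)

lemma score_eq: "score \<alpha> \<sigma> P x = p_grad x /\<^sub>R p x"
  unfolding score_def by (rule grad_eqI[OF has_derivative_ln_p])

lemma has_derivative_ln_p_score: "((\<lambda>x. ln (p x)) has_derivative (\<lambda>v. v \<bullet> score \<alpha> \<sigma> P x)) (at x)"
  unfolding score_eq by (rule has_derivative_ln_p)

lemma borel_measurable_score [measurable]: "score \<alpha> \<sigma> P \<in> borel_measurable borel"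
  unfolding score_eq[abs_def] by measurable

text \<open>With threshold \<open>norm x + R\<close> the exponential remainder in the kernel
  gradient bound is exactly the one in \<open>p_lower_bound\<close>, hence at most
  \<open>p x / \<beta>\<close>. Everything is then a multiple of \<open>p x\<close>, which cancels
  in the score.\<close>

lemma score_linear_growth:
  obtains K where "0 \<le> K" "\<And>x. norm (score \<alpha> \<sigma> P x) \<le> K * (1 + norm x)"
proof -
  obtain R \<beta> where R: "0 \<le> R" and \<beta>: "0 < \<beta>"
    and lower: "\<And>x. \<beta> * (gauss_density 0 \<sigma> (0 :: real^'n) * exp (- (norm x + R)\<^sup>2 / (2 * \<sigma>\<^sup>2))) \<le> p x"
    by (rule p_lower_bound) blast
  define K where "K = (2 * (1 + R) + 2 * \<sigma> / \<beta>) / \<sigma>\<^sup>2"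
  show thesis
  proof
    show "0 \<le> K"
      using R \<beta> sigma_pos by (simp add: K_def)
    fix x :: "real^'n"
    let ?m = "norm x + R"
    let ?e = "gauss_density 0 \<sigma> (0 :: real^'n) * exp (- ?m\<^sup>2 / (2 * \<sigma>\<^sup>2))"
    have "norm (p_grad x) \<le> (\<integral>y. (2 * ?m * gauss_density (\<alpha> *\<^sub>R y) \<sigma> x + 2 * \<sigma> * ?e) / \<sigma>\<^sup>2 \<partial>P)"
      unfolding p_grad_def
    proof (rule order_trans[OF integral_norm_bound integral_mono])
      show "norm ((gauss_density (\<alpha> *\<^sub>R y) \<sigma> x / \<sigma>\<^sup>2) *\<^sub>R (\<alpha> *\<^sub>R y - x))
          \<le> (2 * ?m * gauss_density (\<alpha> *\<^sub>R y) \<sigma> x + 2 * \<sigma> * ?e) / \<sigma>\<^sup>2" for y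
        using R by (intro kernel_grad_norm_le) simp
    qed (auto intro!: integrable_norm integrable_kernel_grad integrable_divide Bochner_Integration.integrable_add
          integrable_mult_right integrable_kernel simp del: norm_scaleR)
    also have "\<dots> = (2 * ?m * p x + 2 * \<sigma> * ?e) / \<sigma>\<^sup>2"
      using integrable_kernel by (simp add: convolved_density_def prob_space)
    also have "\<dots> \<le> (2 * ?m * p x + 2 * \<sigma> * (p x / \<beta>)) / \<sigma>\<^sup>2"
      using lower[of x] \<beta> sigma_pos
      by (intro divide_right_mono add_left_mono mult_left_mono) (auto simp: field_simps)
    also have "\<dots> = (2 * ?m + 2 * \<sigma> / \<beta>) / \<sigma>\<^sup>2 * p x"
      by (simp add: algebra_simps)
    also have "\<dots> \<le> (K * (1 + norm x)) * p x"
    proof (rule mult_right_mono)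
      have "2 * ?m + 2 * \<sigma> / \<beta> \<le> (2 * (1 + R) + 2 * \<sigma> / \<beta>) * (1 + norm x)"
      proof -
        have "0 \<le> R * norm x" "0 \<le> 2 * \<sigma> / \<beta> * norm x"
          using R \<beta> sigma_pos by simp_all
        then show ?thesis
          unfolding distrib_left distrib_right by linarith
      qed
      then show "(2 * ?m + 2 * \<sigma> / \<beta>) / \<sigma>\<^sup>2 \<le> K * (1 + norm x)"
        unfolding K_def times_divide_eq_left by (rule divide_right_mono) simp
    qed (use p_pos[of x] in simp)
    finally show "norm (score \<alpha> \<sigma> P x) \<le> K * (1 + norm x)"
      using p_pos[of x] by (simp add: score_eq field_simps)
  qed
qed

end

section \<open>Functions with linearly growing gradient\<close>

lemma linear_growth_gradient_diff_le:
  fixes f :: "'a::euclidean_space \<Rightarrow> real"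
  assumes D: "\<And>x. (f has_derivative (\<lambda>v. v \<bullet> S x)) (at x)"
    and S: "\<And>x. norm (S x) \<le> K * (1 + norm x)" and K: "0 \<le> K"
  shows "\<bar>f y - f x\<bar> \<le> K * (1 + norm x + norm y) * norm (y - x)"
proof -
  have "norm (f y - f x) \<le> K * (1 + norm x + norm y) * norm (y - x)"
  \<comment> \<open>This ball is convex and contains both points, and the gradient bound is uniform
    on it.\<close>
  proof (rule differentiable_bound[OF convex_cball[of 0 "norm x + norm y"]])
    fix z :: 'a
    assume z: "z \<in> cball 0 (norm x + norm y)"
    show "(f has_derivative (\<lambda>v. v \<bullet> S z)) (at z within cball 0 (norm x + norm y))"
      by (rule has_derivative_at_withinI[OF D])
    have "norm (v \<bullet> S z) \<le> K * (1 + norm x + norm y) * norm v" for v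
    proof -
      have "norm (v \<bullet> S z) \<le> norm v * norm (S z)"
        by (simp only: real_norm_def Cauchy_Schwarz_ineq2)
      also have "\<dots> \<le> norm v * (K * (1 + norm x + norm y))"
        using z K by (intro mult_left_mono order_trans[OF S]) auto
      finally show ?thesis
        by (simp add: mult.commute)
    qed
    then show "onorm (\<lambda>v. v \<bullet> S z) \<le> K * (1 + norm x + norm y)"
      by (rule onorm_le)
  qed auto
  then show ?thesis
    by simp
qed

lemma linear_growth_gradient_quadratic_bound:
  fixes f :: "'a::euclidean_space \<Rightarrow> real"
  assumes D: "\<And>x. (f has_derivative (\<lambda>v. v \<bullet> S x)) (at x)"
    and S: "\<And>x. norm (S x) \<le> K * (1 + norm x)" and K: "0 \<le> K"
  shows "\<bar>f x\<bar> \<le> (\<bar>f 0\<bar> + 2 * K) * (1 + (norm x)\<^sup>2)"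
proof -
  have "\<bar>f x\<bar> \<le> \<bar>f 0\<bar> + K * ((1 + norm x) * norm x)"
    using linear_growth_gradient_diff_le[OF D S K, of x 0] by (simp add: mult.assoc)
  also have "(1 + norm x) * norm x \<le> 2 * (1 + (norm x)\<^sup>2)"
  proof -
    have "2 * norm x \<le> 1 + (norm x)\<^sup>2"
      using zero_le_power2[of "norm x - 1"] by (simp add: power2_diff)
    then have "norm x + (norm x)\<^sup>2 \<le> 2 * (1 + (norm x)\<^sup>2)"
      using norm_ge_zero[of x] zero_le_power2[of "norm x"] unfolding distrib_left by linarith
    then show ?thesis
      by (simp only: distrib_right power2_eq_square mult_1)
  qed
  also have "\<bar>f 0\<bar> + K * (2 * (1 + (norm x)\<^sup>2)) \<le> (\<bar>f 0\<bar> + 2 * K) * (1 + (norm x)\<^sup>2)"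
    by (simp add: algebra_simps)
  finally show ?thesis
    using K by (simp add: mult_left_mono)
qed

section \<open>Noised samples of a generator\<close>

lemma (in pair_prob_space) integrable_compose_fst:
  fixes k :: "'a \<Rightarrow> 'c::{banach, second_countable_topology}"
  assumes k: "integrable M1 k"
  shows "integrable (M1 \<Otimes>\<^sub>M M2) (\<lambda>w. k (fst w))"
  using integrable_distr_eq[of fst "M1 \<Otimes>\<^sub>M M2" M1 k] k by (simp add: M2.distr_pair_fst)

lemma (in pair_prob_space) integral_compose_fst:
  fixes k :: "'a \<Rightarrow> 'c::{banach, second_countable_topology}"
  assumes k: "k \<in> borel_measurable M1"
  shows "(\<integral>w. k (fst w) \<partial>(M1 \<Otimes>\<^sub>M M2)) = (\<integral>z. k z \<partial>M1)"
  using integral_distr[of fst "M1 \<Otimes>\<^sub>M M2" M1 k] k by (simp add: M2.distr_pair_fst)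

lemma (in pair_prob_space) integrable_compose_snd:
  fixes k :: "'b \<Rightarrow> 'c::{banach, second_countable_topology}"
  assumes k: "integrable M2 k"
  shows "integrable (M1 \<Otimes>\<^sub>M M2) (\<lambda>w. k (snd w))"
proof -
  interpret Q: pair_prob_space M2 M1 ..
  show ?thesis
    using Q.integrable_product_swap[OF Q.integrable_compose_fst[OF k]] by (simp add: case_prod_beta')
qed

lemma (in pair_prob_space) AE_compose_fst:
  assumes "AE z in M1. Q z"
  shows "AE w in M1 \<Otimes>\<^sub>M M2. Q (fst w)"
  by (rule AE_distrD[OF measurable_fst]) (subst M2.distr_pair_fst, rule assms)

lemma norm_add_power2_le: "(norm (a + b))\<^sup>2 \<le> 2 * (norm a)\<^sup>2 + 2 * (norm b)\<^sup>2"
  for a b :: "'a::real_normed_vector"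
proof -
  have "(norm (a + b))\<^sup>2 \<le> (norm a + norm b)\<^sup>2"
    by (intro power_mono norm_triangle_ineq) simp
  also have "\<dots> \<le> 2 * (norm a)\<^sup>2 + 2 * (norm b)\<^sup>2"
    using zero_le_power2[of "norm a - norm b"] by (simp add: power2_sum power2_diff)
  finally show ?thesis .
qed

lemma abs_mult_le_add_power2: "\<bar>a * b\<bar> \<le> a\<^sup>2 + b\<^sup>2" for a b :: real
proof -
  have "2 * (\<bar>a\<bar> * \<bar>b\<bar>) \<le> a\<^sup>2 + b\<^sup>2"
    using zero_le_power2[of "\<bar>a\<bar> - \<bar>b\<bar>"] by (simp add: power2_diff)
  moreover have "0 \<le> \<bar>a\<bar> * \<bar>b\<bar>"
    by simp
  ultimately show ?thesis
    unfolding abs_mult by linarith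
qed

text \<open>The second moment is what makes quadratically bounded functions, log densities in
  particular, integrable at the noised sample.\<close>

locale gauss_generator = prob_space M
  for M :: "'a measure" and G :: "'a \<Rightarrow> real^'n" and \<alpha> \<sigma> :: real +
  assumes sigma_pos: "0 < \<sigma>"
    and borel_measurable_G [measurable]: "G \<in> borel_measurable M"
    and integrable_G_sq: "integrable M (\<lambda>z. (norm (G z))\<^sup>2)"
begin

definition noised :: "'a \<times> (real^'n) \<Rightarrow> real^'n" where
  "noised w = \<alpha> *\<^sub>R G (fst w) + \<sigma> *\<^sub>R snd w"

sublocale law: gauss_smoothing "distr M borel G" \<alpha> \<sigma>
  by (intro gauss_smoothing.intro gauss_smoothing_axioms.intro prob_space_distr)
    (simp_all add: sigma_pos)

sublocale pair: pair_prob_space M "std_gaussian :: (real^'n) measure"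
  by (intro pair_prob_space.intro pair_sigma_finite.intro prob_space_imp_sigma_finite prob_space_std_gaussian prob_space_axioms)

abbreviation joint :: "('a \<times> (real^'n)) measure" where
  "joint \<equiv> M \<Otimes>\<^sub>M std_gaussian"

text \<open>The noise factor carries the Lebesgue sets, so the projection is composed with the
  identity into the Borel sets.\<close>

lemma borel_measurable_snd_joint [measurable]: "snd \<in> joint \<rightarrow>\<^sub>M (borel :: (real^'n) measure)"
  using measurable_compose[OF measurable_snd measurable_ident_std_gaussian] .

lemma borel_measurable_noised [measurable]: "noised \<in> borel_measurable joint"
  unfolding noised_def by measurable

lemma ennreal_p: "ennreal (law.p x) = (\<integral>\<^sup>+z. ennreal (gauss_density (\<alpha> *\<^sub>R G z) \<sigma> x) \<partial>M)"
proof -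
  have "ennreal (law.p x) = (\<integral>\<^sup>+y. ennreal (gauss_density (\<alpha> *\<^sub>R y) \<sigma> x) \<partial>distr M borel G)"
    unfolding convolved_density_def
    by (intro nn_integral_eq_integral[symmetric] law.integrable_kernel AE_I2 gauss_density_nonneg)
  also have "\<dots> = (\<integral>\<^sup>+z. ennreal (gauss_density (\<alpha> *\<^sub>R G z) \<sigma> x) \<partial>M)"
    by (rule nn_integral_distr) measurable
  finally show ?thesis .
qed

text \<open>Integrating out the noise turns each latent into its kernel, and Tonelli averages the
  kernels to \<open>law.p\<close>. So \<open>law.p\<close> is the density of the noised
  sample.\<close>

lemma nn_integral_noised:
  assumes f [measurable]: "f \<in> borel_measurable borel"
  shows "(\<integral>\<^sup>+w. f (noised w) \<partial>joint) = (\<integral>\<^sup>+x. ennreal (law.p x) * f x \<partial>lborel)"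
proof -
  interpret Q: pair_sigma_finite M "lborel :: (real^'n) measure" ..
  have "(\<integral>\<^sup>+w. f (noised w) \<partial>joint) = (\<integral>\<^sup>+z. \<integral>\<^sup>+\<epsilon>. f (\<alpha> *\<^sub>R G z + \<sigma> *\<^sub>R \<epsilon>) \<partial>std_gaussian \<partial>M)"
    by (subst pair.M2.nn_integral_fst[symmetric]) (simp_all add: noised_def)
  also have "\<dots> = (\<integral>\<^sup>+z. \<integral>\<^sup>+x. ennreal (gauss_density (\<alpha> *\<^sub>R G z) \<sigma> x) * f x \<partial>lborel \<partial>M)"
    using sigma_pos by (simp add: nn_integral_std_gaussian_affine)
  also have "\<dots> = (\<integral>\<^sup>+x. \<integral>\<^sup>+z. ennreal (gauss_density (\<alpha> *\<^sub>R G z) \<sigma> x) * f x \<partial>M \<partial>lborel)"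
    by (rule Q.Fubini'[symmetric]) measurable
  also have "\<dots> = (\<integral>\<^sup>+x. ennreal (law.p x) * f x \<partial>lborel)"
    by (simp add: nn_integral_multc ennreal_p)
  finally show ?thesis .
qed

lemma distr_noised: "distr joint borel noised = density lborel (\<lambda>x. ennreal (law.p x))"
proof (rule measure_eqI)
  fix A :: "(real^'n) set"
  assume "A \<in> sets (distr joint borel noised)"
  then have A [measurable]: "A \<in> sets borel"
    by simp
  have "emeasure (distr joint borel noised) A = (\<integral>\<^sup>+w. indicator A (noised w) \<partial>joint)"
    by (subst nn_integral_distr[of noised _ borel "indicator A", symmetric]) simp_all
  then show "emeasure (distr joint borel noised) A = emeasure (density lborel (\<lambda>x. ennreal (law.p x))) A"
    by (simp add: nn_integral_noised emeasure_density)
qed simp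

lemma integrable_noised_iff:
  fixes f :: "real^'n \<Rightarrow> real"
  assumes [measurable]: "f \<in> borel_measurable borel"
  shows "integrable lborel (\<lambda>x. law.p x * f x) \<longleftrightarrow> integrable joint (\<lambda>w. f (noised w))"
proof -
  have "integrable (distr joint borel noised) f \<longleftrightarrow> integrable joint (\<lambda>w. f (noised w))"
    by (rule integrable_distr_eq) measurable
  then show ?thesis
    unfolding distr_noised using law.p_pos
    by (subst (asm) integrable_density) (simp_all add: less_imp_le)
qed

lemma integral_noised:
  fixes f :: "real^'n \<Rightarrow> real"
  assumes [measurable]: "f \<in> borel_measurable borel"
  shows "(\<integral>x. law.p x * f x \<partial>lborel) = (\<integral>w. f (noised w) \<partial>joint)"
proof -
  have "integral\<^sup>L (distr joint borel noised) f = (\<integral>w. f (noised w) \<partial>joint)"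
    by (rule integral_distr) measurable
  then show ?thesis
    unfolding distr_noised using law.p_pos
    by (subst (asm) integral_density) (simp_all add: less_imp_le)
qed

lemma nn_integral_p: "(\<integral>\<^sup>+x. ennreal (law.p x) \<partial>lborel) = 1"
  using nn_integral_noised[of "\<lambda>_. 1"] by (simp add: pair.emeasure_space_1)

lemma integrable_noised_norm_sq: "integrable joint (\<lambda>w. (norm (noised w))\<^sup>2)"
proof (rule Bochner_Integration.integrable_bound)
  show "integrable joint (\<lambda>w. 2 * (\<alpha>\<^sup>2 * (norm (G (fst w)))\<^sup>2) + 2 * (\<sigma>\<^sup>2 * (norm (snd w))\<^sup>2))"
    by (intro Bochner_Integration.integrable_add integrable_mult_right
        pair.integrable_compose_fst[OF integrable_G_sq]
        pair.integrable_compose_snd[OF integrable_std_gaussian_norm_sq])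
  show "AE w in joint. norm ((norm (noised w))\<^sup>2)
      \<le> norm (2 * (\<alpha>\<^sup>2 * (norm (G (fst w)))\<^sup>2) + 2 * (\<sigma>\<^sup>2 * (norm (snd w))\<^sup>2))"
    using norm_add_power2_le[of "\<alpha> *\<^sub>R G _" "\<sigma> *\<^sub>R _"]
    by (intro AE_I2) (simp add: noised_def power_mult_distrib)
qed measurable

lemma integrable_noised_quadratic:
  fixes f :: "real^'n \<Rightarrow> real"
  assumes [measurable]: "f \<in> borel_measurable borel"
    and le: "\<And>x. \<bar>f x\<bar> \<le> C * (1 + (norm x)\<^sup>2)"
  shows "integrable joint (\<lambda>w. f (noised w))"
proof (rule Bochner_Integration.integrable_bound)
  show "integrable joint (\<lambda>w. C * (1 + (norm (noised w))\<^sup>2))"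
    by (intro integrable_mult_right Bochner_Integration.integrable_add integrable_noised_norm_sq) simp
  show "AE w in joint. norm (f (noised w)) \<le> norm (C * (1 + (norm (noised w))\<^sup>2))"
    by (intro AE_I2) (metis abs_ge_self le order_trans real_norm_def)
qed measurable

end

lemma (in gauss_smoothing) ln_p_quadratic_bound:
  obtains C where "\<And>x. \<bar>ln (p x)\<bar> \<le> C * (1 + (norm x)\<^sup>2)"
proof -
  obtain K where "0 \<le> K" "\<And>x. norm (score \<alpha> \<sigma> P x) \<le> K * (1 + norm x)"
    by (rule score_linear_growth) blast
  from linear_growth_gradient_quadratic_bound[OF has_derivative_ln_p_score this(2,1)] that
  show thesis
    by blast
qed

text \<open>\<open>Q\<close> need not be the law of the generator. This freedom permits logarithms
  of three different densities at one sample to be split and recombined.\<close>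

lemma (in gauss_generator) integrable_noised_ln_p:
  assumes "gauss_smoothing Q \<sigma>"
  shows "integrable joint (\<lambda>w. ln (convolved_density \<alpha> \<sigma> Q (noised w)))"
proof -
  interpret Q: gauss_smoothing Q \<alpha> \<sigma> by fact
  obtain C where "\<And>x. \<bar>ln (Q.p x)\<bar> \<le> C * (1 + (norm x)\<^sup>2)"
    by (rule Q.ln_p_quadratic_bound) blast
  then show ?thesis
    by (intro integrable_noised_quadratic) measurable
qed

section \<open>Relative entropy of two smoothed generators\<close>

text \<open>From \<open>ln y \<le> y - 1\<close>. Both bounds on the relative entropy arise from
  this with a suitable likelihood ratio as \<open>Y\<close>.\<close>

lemma (in prob_space) integral_ln_nonpos:
  fixes Y :: "'a \<Rightarrow> real"
  assumes [measurable]: "Y \<in> borel_measurable M" and pos: "\<And>w. 0 < Y w"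
    and le: "(\<integral>\<^sup>+w. ennreal (Y w) \<partial>M) \<le> 1" and ln: "integrable M (\<lambda>w. ln (Y w))"
  shows "(\<integral>w. ln (Y w) \<partial>M) \<le> 0"
proof -
  have Y: "integrable M Y"
    by (intro integrableI_nonneg AE_I2 less_imp_le[OF pos] le_less_trans[OF le]) simp_all
  have "ennreal (\<integral>w. Y w \<partial>M) \<le> 1"
    using le nn_integral_eq_integral[OF Y] pos by (simp add: less_imp_le)
  then have "(\<integral>w. Y w \<partial>M) \<le> 1"
    by (simp add: ennreal_le_1)
  moreover have "(\<integral>w. ln (Y w) \<partial>M) \<le> (\<integral>w. Y w - 1 \<partial>M)"
    using ln Y pos by (intro integral_mono) (auto intro: ln_le_minus_one)
  ultimately show ?thesis
    using Y by (simp add: prob_space)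
qed

text \<open>The exponential is the likelihood ratio of the shifted to the unshifted noise; it moves the mean
  of the sample from \<open>m\<close> to \<open>m - \<sigma> u\<close>.\<close>

lemma nn_integral_std_gaussian_shift:
  fixes u m :: "real^'n"
  assumes F [measurable]: "F \<in> borel_measurable borel"
  shows "(\<integral>\<^sup>+\<epsilon>. ennreal (exp (- (((norm (u + \<epsilon>))\<^sup>2 - (norm \<epsilon>)\<^sup>2) / 2))) * F (m + \<sigma> *\<^sub>R \<epsilon>) \<partial>std_gaussian)
    = (\<integral>\<^sup>+\<epsilon>. F (m - \<sigma> *\<^sub>R u + \<sigma> *\<^sub>R \<epsilon>) \<partial>std_gaussian)"
proof -
  have eq: "gauss_density 0 1 \<epsilon> * exp (- (((norm (u + \<epsilon>))\<^sup>2 - (norm \<epsilon>)\<^sup>2) / 2)) = gauss_density 0 1 (u + \<epsilon>)"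
    for \<epsilon> :: "real^'n"
    by (simp add: gauss_density_def exp_add[symmetric] diff_divide_distrib)
  have "(\<integral>\<^sup>+\<epsilon>. ennreal (exp (- (((norm (u + \<epsilon>))\<^sup>2 - (norm \<epsilon>)\<^sup>2) / 2))) * F (m + \<sigma> *\<^sub>R \<epsilon>) \<partial>std_gaussian)
    = (\<integral>\<^sup>+\<epsilon>. ennreal (gauss_density 0 1 (u + \<epsilon>)) * F (m - \<sigma> *\<^sub>R u + \<sigma> *\<^sub>R (u + \<epsilon>)) \<partial>lborel)"
    by (subst nn_integral_std_gaussian)
      (simp_all add: eq[symmetric] ennreal_mult gauss_density_nonneg mult.assoc scaleR_add_right)
  also have "\<dots> = (\<integral>\<^sup>+\<epsilon>. ennreal (gauss_density 0 1 \<epsilon>) * F (m - \<sigma> *\<^sub>R u + \<sigma> *\<^sub>R \<epsilon>) \<partial>distr lborel borel ((+) u))"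
    by (subst nn_integral_distr) simp_all
  also have "\<dots> = (\<integral>\<^sup>+\<epsilon>. F (m - \<sigma> *\<^sub>R u + \<sigma> *\<^sub>R \<epsilon>) \<partial>std_gaussian)"
    by (simp add: lborel_distr_plus nn_integral_std_gaussian)
  finally show ?thesis .
qed

context gauss_generator
begin

text \<open>Gibbs' inequality: the expectation of \<open>Q.p / law.p\<close> at the noised sample is
  the total mass of \<open>Q.p\<close>.\<close>

lemma KL_nonneg:
  assumes Q: "gauss_smoothing Q \<sigma>" and total: "(\<integral>\<^sup>+x. ennreal (convolved_density \<alpha> \<sigma> Q x) \<partial>lborel) \<le> 1"
  shows "0 \<le> (\<integral>w. ln (law.p (noised w)) - ln (convolved_density \<alpha> \<sigma> Q (noised w)) \<partial>joint)"
proof -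
  interpret Q: gauss_smoothing Q \<alpha> \<sigma> by fact
  let ?Y = "\<lambda>w. Q.p (noised w) / law.p (noised w)"
  have ln_Y: "ln (?Y w) = ln (Q.p (noised w)) - ln (law.p (noised w))" for w
    using Q.p_pos[of "noised w"] law.p_pos[of "noised w"] by (simp add: ln_div)
  have "(\<integral>\<^sup>+w. ennreal (?Y w) \<partial>joint) = (\<integral>\<^sup>+x. ennreal (law.p x) * ennreal (Q.p x / law.p x) \<partial>lborel)"
    by (rule nn_integral_noised[of "\<lambda>x. ennreal (Q.p x / law.p x)"]) measurable
  also have "\<dots> = (\<integral>\<^sup>+x. ennreal (Q.p x) \<partial>lborel)"
    using law.p_pos Q.p_pos
    by (intro nn_integral_cong) (simp add: ennreal_mult[symmetric] less_imp_le less_imp_neq[symmetric])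
  finally have "(\<integral>w. ln (?Y w) \<partial>joint) \<le> 0"
    using total integrable_noised_ln_p[OF law.gauss_smoothing_axioms] integrable_noised_ln_p[OF Q]
    by (intro pair.integral_ln_nonpos) (simp_all add: ln_Y Q.p_pos law.p_pos)
  then show ?thesis
    using integrable_noised_ln_p[OF law.gauss_smoothing_axioms] integrable_noised_ln_p[OF Q]
    unfolding ln_Y by simp
qed

text \<open>The ratio of the marginal densities times \<open>exp (- L w)\<close> has expectation 1,
  so its logarithm has nonpositive mean. This says that the relative entropy is at most the mean of
  \<open>L\<close>, in which the term linear in the noise vanishes.\<close>

lemma KL_le:
  assumes H: "gauss_generator M H \<sigma>"
  shows "(\<integral>w. ln (law.p (noised w)) - ln (convolved_density \<alpha> \<sigma> (distr M borel H) (noised w)) \<partial>joint)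
    \<le> \<alpha>\<^sup>2 / (2 * \<sigma>\<^sup>2) * (\<integral>z. (norm (G z - H z))\<^sup>2 \<partial>M)"
proof -
  interpret H: gauss_generator M H \<alpha> \<sigma> by fact
  \<comment> \<open>The displacement of the means in units of \<sigma>: the noise
    \<open>u z + \<epsilon>\<close> added to \<open>H\<close> yields the same sample as \<epsilon>
    added to \<open>G\<close>.\<close>
  define u where "u z = (\<alpha> / \<sigma>) *\<^sub>R (G z - H z)" for z
  have [measurable]: "u \<in> borel_measurable M"
    unfolding u_def by measurable
  have int_sq: "integrable M (\<lambda>z. (norm (G z - H z))\<^sup>2)"
  proof (rule Bochner_Integration.integrable_bound)
    show "integrable M (\<lambda>z. 2 * (norm (G z))\<^sup>2 + 2 * (norm (H z))\<^sup>2)"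
      using integrable_G_sq H.integrable_G_sq by simp
    show "AE z in M. norm ((norm (G z - H z))\<^sup>2) \<le> norm (2 * (norm (G z))\<^sup>2 + 2 * (norm (H z))\<^sup>2)"
      using norm_add_power2_le[of "G _" "- H _"] by (intro AE_I2) simp
  qed measurable
  have u_sq: "(norm (u z))\<^sup>2 = \<alpha>\<^sup>2 / \<sigma>\<^sup>2 * (norm (G z - H z))\<^sup>2" for z
    by (simp add: u_def power_mult_distrib power_divide)
  have int_u: "integrable M (\<lambda>z. (norm (u z))\<^sup>2)"
    unfolding u_sq using int_sq by simp
  \<comment> \<open>\<open>L\<close> is the log-likelihood ratio of the kernels centred at \<open>\<alpha> G\<close> and \<open>\<alpha> H\<close>; its expectation is the
    relative entropy of the joint laws of latent and sample, which dominates that of the marginals.\<close>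
  define L where "L w = ((norm (u (fst w) + snd w))\<^sup>2 - (norm (snd w))\<^sup>2) / 2" for w
  have L: "L w = u (fst w) \<bullet> snd w + (norm (u (fst w)))\<^sup>2 / 2" for w
    by (simp add: L_def power2_norm_eq_inner inner_add_left inner_add_right inner_commute)
  have [measurable]: "L \<in> borel_measurable joint"
    unfolding L_def by measurable
  have int_inner: "integrable joint (\<lambda>w. u (fst w) \<bullet> snd w)"
  proof (rule Bochner_Integration.integrable_bound)
    show "integrable joint (\<lambda>w. (norm (u (fst w)))\<^sup>2 + (norm (snd w))\<^sup>2)"
      by (intro Bochner_Integration.integrable_add pair.integrable_compose_fst[OF int_u]
          pair.integrable_compose_snd[OF integrable_std_gaussian_norm_sq])
    have "\<bar>a \<bullet> b\<bar> \<le> (norm a)\<^sup>2 + (norm b)\<^sup>2" for a b :: "real^'n"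
      using Cauchy_Schwarz_ineq2[of a b] abs_mult_le_add_power2[of "norm a" "norm b"] by simp
    then show "AE w in joint. norm (u (fst w) \<bullet> snd w) \<le> norm ((norm (u (fst w)))\<^sup>2 + (norm (snd w))\<^sup>2)"
      by (intro AE_I2) simp
  qed measurable
  have int_u': "integrable joint (\<lambda>w. (norm (u (fst w)))\<^sup>2)"
    by (rule pair.integrable_compose_fst[OF int_u])
  have int_L: "integrable joint L"
    unfolding L using int_inner int_u' by simp
  have "(\<integral>w. u (fst w) \<bullet> snd w \<partial>joint) = (\<integral>z. \<integral>\<epsilon>. u z \<bullet> \<epsilon> \<partial>std_gaussian \<partial>M)"
    by (subst pair.integral_fst'[OF int_inner, symmetric]) simp
  also have "\<dots> = 0"
    by (simp add: integral_std_gaussian_inner)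
  finally have "(\<integral>w. L w \<partial>joint) = (\<integral>z. (norm (u z))\<^sup>2 \<partial>M) / 2"
    unfolding L using int_inner int_u' pair.integral_compose_fst[OF borel_measurable_integrable[OF int_u]]
    by simp
  also have "\<dots> = \<alpha>\<^sup>2 / (2 * \<sigma>\<^sup>2) * (\<integral>z. (norm (G z - H z))\<^sup>2 \<partial>M)"
    by (simp add: u_sq)
  finally have integral_L: "(\<integral>w. L w \<partial>joint) = \<alpha>\<^sup>2 / (2 * \<sigma>\<^sup>2) * (\<integral>z. (norm (G z - H z))\<^sup>2 \<partial>M)" .
  let ?R = "\<lambda>x. law.p x / H.law.p x"
  let ?Y = "\<lambda>w. ?R (noised w) * exp (- L w)"
  have R_pos: "0 < ?R x" for x
    using law.p_pos[of x] H.law.p_pos[of x] by simp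
  have ln_Y: "ln (?Y w) = ln (law.p (noised w)) - ln (H.law.p (noised w)) - L w" for w
    using R_pos[of "noised w"] law.p_pos[of "noised w"] H.law.p_pos[of "noised w"]
    by (simp add: ln_mult ln_div)
  have "(\<integral>\<^sup>+w. ennreal (?Y w) \<partial>joint)
    = (\<integral>\<^sup>+z. \<integral>\<^sup>+\<epsilon>. ennreal (exp (- (((norm (u z + \<epsilon>))\<^sup>2 - (norm \<epsilon>)\<^sup>2) / 2))) *
        ennreal (?R (\<alpha> *\<^sub>R G z + \<sigma> *\<^sub>R \<epsilon>)) \<partial>std_gaussian \<partial>M)"
    using R_pos
    by (subst pair.M2.nn_integral_fst[symmetric], measurable)
      (simp add: noised_def L_def ennreal_mult''[symmetric] mult.commute less_imp_le)
  \<comment> \<open>The weight \<open>exp (- L w)\<close> is traded for a shift of the mean. The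
    sample becomes that of \<open>H\<close>, whose density cancels the denominator of
    \<open>?R\<close>.\<close>
  also have "\<dots> = (\<integral>\<^sup>+z. \<integral>\<^sup>+\<epsilon>. ennreal (?R (\<alpha> *\<^sub>R G z - \<sigma> *\<^sub>R u z + \<sigma> *\<^sub>R \<epsilon>)) \<partial>std_gaussian \<partial>M)"
    by (subst nn_integral_std_gaussian_shift) simp_all
  also have "\<dots> = (\<integral>\<^sup>+z. \<integral>\<^sup>+\<epsilon>. ennreal (?R (\<alpha> *\<^sub>R H z + \<sigma> *\<^sub>R \<epsilon>)) \<partial>std_gaussian \<partial>M)"
    using sigma_pos by (simp add: u_def scaleR_diff_right)
  also have "\<dots> = (\<integral>\<^sup>+w. ennreal (?R (H.noised w)) \<partial>joint)"
    by (subst pair.M2.nn_integral_fst[symmetric], measurable) (simp add: H.noised_def)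
  also have "\<dots> = (\<integral>\<^sup>+x. ennreal (H.law.p x) * ennreal (?R x) \<partial>lborel)"
    by (rule H.nn_integral_noised[of "\<lambda>x. ennreal (?R x)"]) measurable
  also have "\<dots> = (\<integral>\<^sup>+x. ennreal (law.p x) \<partial>lborel)"
    using law.p_pos H.law.p_pos
    by (intro nn_integral_cong) (simp add: ennreal_mult[symmetric] less_imp_le less_imp_neq[symmetric])
  also have "\<dots> = 1"
    by (rule nn_integral_p)
  finally have Y_total: "(\<integral>\<^sup>+w. ennreal (?Y w) \<partial>joint) = 1" .
  note ints = integrable_noised_ln_p[OF law.gauss_smoothing_axioms]
    integrable_noised_ln_p[OF H.law.gauss_smoothing_axioms] int_L
  have int_ln_Y: "integrable joint (\<lambda>w. ln (?Y w))"
    unfolding ln_Y using ints by simp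
  have Y_meas: "?Y \<in> borel_measurable joint"
    by measurable
  have Y_pos: "0 < ?Y w" for w
    using R_pos[of "noised w"] by (intro mult_pos_pos) auto
  have "(\<integral>w. ln (?Y w) \<partial>joint) \<le> 0"
    by (rule pair.integral_ln_nonpos[OF Y_meas Y_pos _ int_ln_Y]) (simp only: Y_total order_refl)
  then show ?thesis
    unfolding ln_Y using ints integral_L by simp
qed

end

section \<open>The gradient formula\<close>

text \<open>A vanishing integral would force the positive integrand to be zero almost everywhere.
  Positivity keeps the division in \<open>target_law\<close> genuine.\<close>

lemma partition_const_pos:
  fixes E :: "real^'n \<Rightarrow> real"
  assumes "integrable lborel (\<lambda>x. exp (- E x))"
  shows "0 < partition_const E"
proof -
  have "partition_const E \<noteq> 0"
  proof
    assume "partition_const E = 0"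
    then have "AE x in (lborel :: (real^'n) measure). False"
      using integral_nonneg_eq_0_iff_AE[OF assms] by (simp add: partition_const_def)
    then show False
      by (simp add: AE_iff_null null_sets_def)
  qed
  moreover have "0 \<le> partition_const E"
    unfolding partition_const_def by (rule Bochner_Integration.integral_nonneg) simp
  ultimately show ?thesis
    by simp
qed

lemma gauss_smoothing_target_law:
  assumes int: "integrable lborel (\<lambda>x. exp (- E x))" and "0 < \<sigma>"
  shows "gauss_smoothing (target_law E) \<sigma>"
proof (intro gauss_smoothing.intro gauss_smoothing_axioms.intro prob_spaceI)
  have [measurable]: "(\<lambda>x. exp (- E x)) \<in> borel_measurable borel"
    using borel_measurable_integrable[OF int] by simp
  have "emeasure (target_law E) (space (target_law E)) = (\<integral>\<^sup>+x. ennreal (exp (- E x) / partition_const E) \<partial>lborel)"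
    by (simp add: target_law_def emeasure_density)
  also have "\<dots> = ennreal (\<integral>x. exp (- E x) / partition_const E \<partial>lborel)"
    using int partition_const_pos[OF int]
    by (intro nn_integral_eq_integral AE_I2) (auto intro: less_imp_le)
  also have "\<dots> = 1"
    using partition_const_pos[OF int] by (simp add: partition_const_def)
  finally show "emeasure (target_law E) (space (target_law E)) = 1" .
qed (simp_all add: target_law_def assms)

lemma has_derivative_zero_quadratic:
  fixes f :: "'a::real_normed_vector \<Rightarrow> real"
  assumes r: "0 < r" and le: "\<And>y. y \<in> ball x r \<Longrightarrow> \<bar>f y\<bar> \<le> C * (norm (y - x))\<^sup>2"
  shows "(f has_derivative (\<lambda>_. 0)) (at x)"
proof (rule has_derivativeI_sandwich[OF r])
  have fx: "f x = 0"
    using le[of x] r by simp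
  fix y assume y: "y \<noteq> x" "dist y x < r"
  then have "\<bar>f y\<bar> \<le> C * norm (y - x) * norm (y - x)"
    using le[of y] by (simp add: dist_commute power2_eq_square mult.assoc)
  then show "norm (f y - f x - 0) / norm (y - x) \<le> C * norm (y - x)"
    using y fx by (simp add: divide_le_eq)
next
  show "((\<lambda>y. C * norm (y - x)) \<longlongrightarrow> 0) (at x)"
    by (auto intro!: tendsto_eq_intros)
qed simp

text \<open>No differentiability is needed: both choices defining \<open>frechet_derivative\<close> are over the same
  predicate, so the junk values agree too. In particular the Jacobian never depends on \<open>\<epsilon>\<close>, which
  matters because the product measure is not complete.\<close>

lemma jacobian_noised_sample:
  "jacobian (noised_sample \<alpha> \<sigma> g z \<epsilon>) (at \<theta>) = jacobian (\<lambda>\<theta>'. \<alpha> *\<^sub>R g \<theta>' z) (at \<theta>)"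
  by (simp add: jacobian_def frechet_derivative_def has_derivative_at noised_sample_def)

text \<open>\<open>h\<close> is square integrable because increments of the log ratio involve the
  norm of the sample times \<open>h\<close>, and also the square of \<open>h\<close>.\<close>

locale lipschitz_generator_family =
  fixes g :: "real^'p \<Rightarrow> real^'m \<Rightarrow> real^'n" and \<theta> :: "real^'p"
    and \<alpha> \<sigma> r :: real and h :: "real^'m \<Rightarrow> real" and Q :: "(real^'n) measure"
  assumes Q: "gauss_smoothing Q \<sigma>"
    and g_meas: "\<And>\<theta>'. g \<theta>' \<in> borel_measurable std_gaussian"
    and g_sq: "integrable std_gaussian (\<lambda>z. (norm (g \<theta> z))\<^sup>2)"
    and g_diff: "AE z in std_gaussian. (\<lambda>\<theta>'. g \<theta>' z) differentiable (at \<theta>)"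
    and r_pos: "0 < r"
    and h_meas [measurable]: "h \<in> borel_measurable std_gaussian"
    and h_sq: "integrable std_gaussian (\<lambda>z. (h z)\<^sup>2)"
    and g_lip: "AE z in std_gaussian. \<forall>\<theta>' \<in> ball \<theta> r. norm (g \<theta>' z - g \<theta> z) \<le> h z * norm (\<theta>' - \<theta>)"
begin

sublocale Q: gauss_smoothing Q \<alpha> \<sigma>
  by (rule Q)

lemma g_lip_sq:
  assumes "\<theta>' \<in> ball \<theta> r"
  shows "AE z in std_gaussian. (norm (g \<theta>' z - g \<theta> z))\<^sup>2 \<le> (h z)\<^sup>2 * (norm (\<theta>' - \<theta>))\<^sup>2"
  using g_lip
proof eventually_elim
  case (elim z)
  then show ?case
    using assms by (metis norm_ge_zero power_mono power_mult_distrib)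
qed

text \<open>The centred Lipschitz bound carries the second moment from \<theta> to the whole
  ball.\<close>

lemma g_generator:
  assumes \<theta>': "\<theta>' \<in> ball \<theta> r"
  shows "gauss_generator std_gaussian (g \<theta>') \<sigma>"
proof (intro gauss_generator.intro gauss_generator_axioms.intro prob_space_std_gaussian Q.sigma_pos g_meas)
  show "integrable std_gaussian (\<lambda>z. (norm (g \<theta>' z))\<^sup>2)"
  proof (rule Bochner_Integration.integrable_bound)
    show "integrable std_gaussian (\<lambda>z. 2 * ((h z)\<^sup>2 * (norm (\<theta>' - \<theta>))\<^sup>2) + 2 * (norm (g \<theta> z))\<^sup>2)"
      using h_sq g_sq by simp
    show "AE z in std_gaussian. norm ((norm (g \<theta>' z))\<^sup>2)
        \<le> norm (2 * ((h z)\<^sup>2 * (norm (\<theta>' - \<theta>))\<^sup>2) + 2 * (norm (g \<theta> z))\<^sup>2)"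
      using g_lip_sq[OF \<theta>']
    proof eventually_elim
      case (elim z)
      show ?case
        using elim norm_add_power2_le[of "g \<theta>' z - g \<theta> z" "g \<theta> z"] by simp
    qed
  qed (use g_meas in measurable)
qed

sublocale base: gauss_generator std_gaussian "g \<theta>" \<alpha> \<sigma>
  by (rule g_generator) (simp add: r_pos)

section \<open>The cross term: integrand, measurability, domination, derivative\<close>

definition log_ratio :: "real^'n \<Rightarrow> real" where
  "log_ratio x = ln (base.law.p x) - ln (Q.p x)"

definition score_diff :: "real^'n \<Rightarrow> real^'n" where
  "score_diff x = score \<alpha> \<sigma> (distr std_gaussian borel (g \<theta>)) x - score \<alpha> \<sigma> Q x"

lemma borel_measurable_score_diff [measurable]: "score_diff \<in> borel_measurable borel"
  unfolding score_diff_def by measurable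

lemma has_derivative_log_ratio: "(log_ratio has_derivative (\<lambda>v. v \<bullet> score_diff x)) (at x)"
  unfolding log_ratio_def score_diff_def inner_diff_right
  by (intro has_derivative_diff base.law.has_derivative_ln_p_score Q.has_derivative_ln_p_score)

lemma score_diff_linear_growth:
  obtains K where "0 \<le> K" "\<And>x. norm (score_diff x) \<le> K * (1 + norm x)"
proof -
  obtain K1 where K1: "0 \<le> K1" "\<And>x. norm (score \<alpha> \<sigma> (distr std_gaussian borel (g \<theta>)) x) \<le> K1 * (1 + norm x)"
    by (rule base.law.score_linear_growth) blast
  obtain K2 where K2: "0 \<le> K2" "\<And>x. norm (score \<alpha> \<sigma> Q x) \<le> K2 * (1 + norm x)"
    by (rule Q.score_linear_growth) blast
  show thesis
  proof
    show "0 \<le> K1 + K2"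
      using K1 K2 by simp
    show "norm (score_diff x) \<le> (K1 + K2) * (1 + norm x)" for x
      using norm_triangle_ineq4[of "score \<alpha> \<sigma> (distr std_gaussian borel (g \<theta>)) x" "score \<alpha> \<sigma> Q x"] K1(2)[of x] K2(2)[of x]
      unfolding score_diff_def distrib_right[of K1 K2] by linarith
  qed
qed

text \<open>The noise is left out of the Jacobian so that this factor is visibly a function of the
  latent.\<close>

definition grad_integrand :: "(real^'m) \<times> (real^'n) \<Rightarrow> real^'p" where
  "grad_integrand w = score_diff (base.noised w) v* jacobian (\<lambda>\<theta>'. \<alpha> *\<^sub>R g \<theta>' (fst w)) (at \<theta>)"

lemma grad_integrand_eq: "grad_integrand (z, \<epsilon>) = DiKL_grad_integrand \<alpha> \<sigma> g Q \<theta> z \<epsilon>"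
  by (simp add: grad_integrand_def DiKL_grad_integrand_def jacobian_noised_sample score_diff_def
      model_law_def base.noised_def noised_sample_def Let_def)

lemma borel_measurable_frechet_derivative_g:
  "(\<lambda>z. frechet_derivative (\<lambda>\<theta>'. \<alpha> *\<^sub>R g \<theta>' z) (at \<theta>) v) \<in> borel_measurable std_gaussian"
proof -
  interpret complete_measure "std_gaussian :: (real^'m) measure"
    by (rule complete_measure_std_gaussian)
  note g_meas [measurable]
  \<comment> \<open>Each quotient is measurable, and the limit agrees with the derivative off a null
    set; completeness absorbs the default values there.\<close>
  let ?q = "\<lambda>n z. real (Suc n) *\<^sub>R (\<alpha> *\<^sub>R g (\<theta> + v /\<^sub>R real (Suc n)) z - \<alpha> *\<^sub>R g \<theta> z)"
  show ?thesis
  proof (rule borel_measurable_AE_eq)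
    show "(\<lambda>z. lim (\<lambda>n. ?q n z)) \<in> borel_measurable std_gaussian"
      by (intro borel_measurable_lim_metric) measurable
    show "AE z in std_gaussian. lim (\<lambda>n. ?q n z) = frechet_derivative (\<lambda>\<theta>'. \<alpha> *\<^sub>R g \<theta>' z) (at \<theta>) v"
      using g_diff
    proof eventually_elim
      case (elim z)
      then have "((\<lambda>\<theta>'. \<alpha> *\<^sub>R g \<theta>' z) has_derivative frechet_derivative (\<lambda>\<theta>'. \<alpha> *\<^sub>R g \<theta>' z) (at \<theta>)) (at \<theta>)"
        by (intro frechet_derivative_works[THEN iffD1] differentiable_scaleR differentiable_const)
      then show ?case
        by (intro limI has_derivative_imp_LIMSEQ_quotient)
    qed
  qed
qed

lemma borel_measurable_grad_integrand: "grad_integrand \<in> borel_measurable base.joint"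
proof -
  let ?J = "\<lambda>z. jacobian (\<lambda>\<theta>'. \<alpha> *\<^sub>R g \<theta>' z) (at \<theta>)"
  have J: "(\<lambda>z. ?J z $ i $ j) \<in> borel_measurable std_gaussian" for i j
    using borel_measurable_inner[OF borel_measurable_frechet_derivative_g[of "axis j 1"] borel_measurable_const[of "axis i 1"]]
    by (simp add: jacobian_def matrix_def inner_axis)
  have J': "(\<lambda>w. ?J (fst w) $ i $ j) \<in> borel_measurable base.joint" for i j
    by (rule measurable_compose[OF measurable_fst J])
  have "(\<lambda>w. score_diff (base.noised w) \<bullet> axis i 1) \<in> borel_measurable base.joint" for i
    by measurable
  then have S: "(\<lambda>w. score_diff (base.noised w) $ i) \<in> borel_measurable base.joint" for i
    by (simp add: inner_axis)
  have "(\<lambda>w. grad_integrand w \<bullet> b) \<in> borel_measurable base.joint" if b_Basis: "b \<in> Basis" for b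
  proof -
    obtain j where b: "b = axis j 1"
      using b_Basis by (auto simp: Basis_vec_def)
    have eq: "grad_integrand w \<bullet> b = (\<Sum>i\<in>UNIV. score_diff (base.noised w) $ i * ?J (fst w) $ i $ j)" for w
      by (simp add: b inner_axis grad_integrand_def vector_matrix_mult_def mult.commute)
    show ?thesis
      unfolding eq by (intro borel_measurable_sum borel_measurable_times S J')
  qed
  then show ?thesis
    by (subst borel_measurable_euclidean_space) blast
qed

lemma has_derivative_log_ratio_noised:
  "AE w in base.joint. ((\<lambda>\<theta>'. log_ratio (\<alpha> *\<^sub>R g \<theta>' (fst w) + \<sigma> *\<^sub>R snd w))
    has_derivative (\<lambda>v. v \<bullet> grad_integrand w)) (at \<theta>)"
  using base.pair.AE_compose_fst[OF g_diff]
proof eventually_elim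
  case (elim w)
  let ?f = "\<lambda>\<theta>'. \<alpha> *\<^sub>R g \<theta>' (fst w)"
  have "?f differentiable (at \<theta>)"
    using elim by (intro differentiable_scaleR differentiable_const)
  then have "(?f has_derivative (\<lambda>v. jacobian ?f (at \<theta>) *v v)) (at \<theta>)"
    by (simp add: jacobian_works)
  then have "((\<lambda>\<theta>'. ?f \<theta>' + \<sigma> *\<^sub>R snd w) has_derivative (\<lambda>v. jacobian ?f (at \<theta>) *v v)) (at \<theta>)"
    by (rule has_derivative_add_const)
  note deriv = has_derivative_compose[OF this has_derivative_log_ratio]
  \<comment> \<open>The row-vector product \<open>v*\<close> is the adjoint of \<open>*v\<close>,
    which turns the chain rule into a gradient.\<close>
  have "v \<bullet> grad_integrand w = (jacobian ?f (at \<theta>) *v v) \<bullet> score_diff (?f \<theta> + \<sigma> *\<^sub>R snd w)" for v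
    unfolding grad_integrand_def base.noised_def by (metis dot_lmul_matrix inner_commute)
  with deriv show ?case
    by simp
qed

text \<open>With \<open>a = \<bar>\<alpha>\<bar> * \<bar>h (fst w)\<bar>\<close> and
  \<open>x\<close> the base sample this is \<open>K * (1 + 2 * norm x + r * a) * a\<close> expanded:
  samples in the ball move by at most \<open>a\<close> times the parameter change, hence by at most
  \<open>r * a\<close>.\<close>

definition lipschitz_bound :: "real \<Rightarrow> (real^'m) \<times> (real^'n) \<Rightarrow> real" where
  "lipschitz_bound K w = K * (\<bar>\<alpha>\<bar> * \<bar>h (fst w)\<bar> + 2 * (\<bar>\<alpha>\<bar> * (norm (base.noised w) * \<bar>h (fst w)\<bar>))
    + r * (\<bar>\<alpha>\<bar> * \<bar>h (fst w)\<bar>)\<^sup>2)"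

lemma integrable_lipschitz_bound: "integrable base.joint (lipschitz_bound K)"
proof -
  have h: "integrable base.joint (\<lambda>w. (h (fst w))\<^sup>2)"
    by (rule base.pair.integrable_compose_fst[OF h_sq])
  have [measurable]: "(\<lambda>w. h (fst w)) \<in> borel_measurable base.joint"
    by measurable
  have 1: "integrable base.joint (\<lambda>w. \<bar>h (fst w)\<bar>)"
  proof (rule Bochner_Integration.integrable_bound)
    show "integrable base.joint (\<lambda>w. 1 + (h (fst w))\<^sup>2)"
      using h by simp
    show "AE w in base.joint. norm \<bar>h (fst w)\<bar> \<le> norm (1 + (h (fst w))\<^sup>2)"
      using abs_mult_le_add_power2[of 1 "h _"] by (intro AE_I2) simp
  qed measurable
  have 2: "integrable base.joint (\<lambda>w. norm (base.noised w) * \<bar>h (fst w)\<bar>)"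
  proof (rule Bochner_Integration.integrable_bound)
    show "integrable base.joint (\<lambda>w. (norm (base.noised w))\<^sup>2 + (h (fst w))\<^sup>2)"
      using h base.integrable_noised_norm_sq by simp
    show "AE w in base.joint. norm (norm (base.noised w) * \<bar>h (fst w)\<bar>)
        \<le> norm ((norm (base.noised w))\<^sup>2 + (h (fst w))\<^sup>2)"
      using abs_mult_le_add_power2[of "norm (base.noised _)" "h _"] by (intro AE_I2) (simp add: abs_mult)
  qed measurable
  show ?thesis
    unfolding lipschitz_bound_def power_mult_distrib
    using 1 2 h by (intro integrable_mult_right Bochner_Integration.integrable_add) simp_all
qed

lemma log_ratio_noised_lipschitz:
  obtains K where "AE w in base.joint. \<forall>\<theta>'\<in>ball \<theta> r.
    \<bar>log_ratio (\<alpha> *\<^sub>R g \<theta>' (fst w) + \<sigma> *\<^sub>R snd w) - log_ratio (\<alpha> *\<^sub>R g \<theta> (fst w) + \<sigma> *\<^sub>R snd w)\<bar>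
      \<le> lipschitz_bound K w * norm (\<theta>' - \<theta>)"
proof -
  obtain K where K: "0 \<le> K" "\<And>x. norm (score_diff x) \<le> K * (1 + norm x)"
    by (rule score_diff_linear_growth) blast
  have "AE w in base.joint. \<forall>\<theta>'\<in>ball \<theta> r.
    \<bar>log_ratio (\<alpha> *\<^sub>R g \<theta>' (fst w) + \<sigma> *\<^sub>R snd w) - log_ratio (\<alpha> *\<^sub>R g \<theta> (fst w) + \<sigma> *\<^sub>R snd w)\<bar>
      \<le> lipschitz_bound K w * norm (\<theta>' - \<theta>)"
    using base.pair.AE_compose_fst[OF g_lip]
  proof eventually_elim
    case (elim w)
    show ?case
    proof
      fix \<theta>' assume \<theta>': "\<theta>' \<in> ball \<theta> r"
      let ?x = "base.noised w" and ?y = "\<alpha> *\<^sub>R g \<theta>' (fst w) + \<sigma> *\<^sub>R snd w"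
      let ?h = "\<bar>\<alpha>\<bar> * \<bar>h (fst w)\<bar>" and ?d = "norm (\<theta>' - \<theta>)"
      have "norm (g \<theta>' (fst w) - g \<theta> (fst w)) \<le> \<bar>h (fst w)\<bar> * ?d"
        using elim \<theta>' by (meson abs_ge_self mult_right_mono norm_ge_zero order_trans)
      then have "\<bar>\<alpha>\<bar> * norm (g \<theta>' (fst w) - g \<theta> (fst w)) \<le> ?h * ?d"
        unfolding mult.assoc by (rule mult_left_mono) simp
      moreover have "?y - ?x = \<alpha> *\<^sub>R (g \<theta>' (fst w) - g \<theta> (fst w))"
        by (simp add: base.noised_def scaleR_diff_right)
      ultimately have diff: "norm (?y - ?x) \<le> ?h * ?d"
        by simp
      also have "\<dots> \<le> ?h * r"
        using \<theta>' by (intro mult_left_mono) (auto simp: dist_norm norm_minus_commute)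
      finally have y: "norm ?y \<le> norm ?x + ?h * r"
        using norm_triangle_sub[of ?y ?x] by simp
      have "\<bar>log_ratio ?y - log_ratio ?x\<bar> \<le> K * (1 + norm ?x + norm ?y) * norm (?y - ?x)"
        by (rule linear_growth_gradient_diff_le[OF has_derivative_log_ratio K(2,1)])
      also have "\<dots> \<le> K * (1 + norm ?x + (norm ?x + ?h * r)) * (?h * ?d)"
        using K y diff r_pos by (intro mult_mono mult_left_mono add_left_mono mult_nonneg_nonneg) auto
      also have "\<dots> = lipschitz_bound K w * ?d"
        by (simp add: lipschitz_bound_def power2_eq_square algebra_simps)
      finally show "\<bar>log_ratio ?y - log_ratio (\<alpha> *\<^sub>R g \<theta> (fst w) + \<sigma> *\<^sub>R snd w)\<bar> \<le> lipschitz_bound K w * ?d"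
        by (simp add: base.noised_def)
    qed
  qed
  then show thesis
    by (rule that)
qed

lemma integrable_log_ratio_noised:
  assumes "gauss_generator std_gaussian G \<sigma>"
  shows "integrable base.joint (\<lambda>w. log_ratio (gauss_generator.noised G \<alpha> \<sigma> w))"
proof -
  interpret G: gauss_generator std_gaussian G \<alpha> \<sigma> by fact
  show ?thesis
    unfolding log_ratio_def
    by (intro Bochner_Integration.integrable_diff G.integrable_noised_ln_p
        base.law.gauss_smoothing_axioms Q.gauss_smoothing_axioms)
qed

lemma
  shows integrable_grad_integrand_inner: "integrable base.joint (\<lambda>w. v \<bullet> grad_integrand w)"
    and has_derivative_cross_term:
      "((\<lambda>\<theta>'. \<integral>w. log_ratio (\<alpha> *\<^sub>R g \<theta>' (fst w) + \<sigma> *\<^sub>R snd w) \<partial>base.joint)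
        has_derivative (\<lambda>v. \<integral>w. v \<bullet> grad_integrand w \<partial>base.joint)) (at \<theta>)"
proof -
  obtain K where K: "AE w in base.joint. \<forall>\<theta>'\<in>ball \<theta> r.
    \<bar>log_ratio (\<alpha> *\<^sub>R g \<theta>' (fst w) + \<sigma> *\<^sub>R snd w) - log_ratio (\<alpha> *\<^sub>R g \<theta> (fst w) + \<sigma> *\<^sub>R snd w)\<bar>
      \<le> lipschitz_bound K w * norm (\<theta>' - \<theta>)"
    by (rule log_ratio_noised_lipschitz)
  have int: "integrable base.joint (\<lambda>w. log_ratio (\<alpha> *\<^sub>R g \<theta>' (fst w) + \<sigma> *\<^sub>R snd w))"
    if "\<theta>' \<in> ball \<theta> r" for \<theta>'
    using integrable_log_ratio_noised[OF g_generator[OF that]]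
    by (simp add: gauss_generator.noised_def[OF g_generator[OF that]])
  have meas: "(\<lambda>w. v \<bullet> grad_integrand w) \<in> borel_measurable base.joint" for v
    by (intro borel_measurable_inner borel_measurable_grad_integrand borel_measurable_const)
  note facts = r_pos int has_derivative_log_ratio_noised meas K integrable_lipschitz_bound
  show "integrable base.joint (\<lambda>w. v \<bullet> grad_integrand w)"
    by (rule has_derivative_integral_integrable[OF facts])
  show "((\<lambda>\<theta>'. \<integral>w. log_ratio (\<alpha> *\<^sub>R g \<theta>' (fst w) + \<sigma> *\<^sub>R snd w) \<partial>base.joint)
        has_derivative (\<lambda>v. \<integral>w. v \<bullet> grad_integrand w \<partial>base.joint)) (at \<theta>)"
    by (rule has_derivative_integral[OF facts])
qed

lemma integrable_grad_integrand: "integrable base.joint grad_integrand"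
proof -
  have "integrable base.joint (\<lambda>w. \<Sum>b\<in>Basis. (b \<bullet> grad_integrand w) *\<^sub>R b)"
    by (intro Bochner_Integration.integrable_sum integrable_scaleR_left integrable_grad_integrand_inner)
  then show ?thesis
    by (simp add: inner_commute[of _ "grad_integrand _"] euclidean_representation)
qed

section \<open>The remainder and the assembly of the divergence\<close>

definition relative_entropy :: "real^'p \<Rightarrow> real" where
  "relative_entropy \<theta>' = (\<integral>w. ln (convolved_density \<alpha> \<sigma> (model_law g \<theta>') (\<alpha> *\<^sub>R g \<theta>' (fst w) + \<sigma> *\<^sub>R snd w))
    - ln (base.law.p (\<alpha> *\<^sub>R g \<theta>' (fst w) + \<sigma> *\<^sub>R snd w)) \<partial>base.joint)"

lemma relative_entropy_quadratic:
  assumes \<theta>': "\<theta>' \<in> ball \<theta> r"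
  shows "\<bar>relative_entropy \<theta>'\<bar>
    \<le> \<alpha>\<^sup>2 / (2 * \<sigma>\<^sup>2) * (\<integral>z. (h z)\<^sup>2 \<partial>std_gaussian) * (norm (\<theta>' - \<theta>))\<^sup>2"
proof -
  interpret G: gauss_generator std_gaussian "g \<theta>'" \<alpha> \<sigma>
    by (rule g_generator[OF \<theta>'])
  have eq: "relative_entropy \<theta>' = (\<integral>w. ln (G.law.p (G.noised w)) - ln (base.law.p (G.noised w)) \<partial>base.joint)"
    by (simp add: relative_entropy_def model_law_def G.noised_def)
  have "0 \<le> relative_entropy \<theta>'"
    unfolding eq by (rule G.KL_nonneg[OF base.law.gauss_smoothing_axioms]) (simp add: base.nn_integral_p)
  moreover have "relative_entropy \<theta>' \<le> \<alpha>\<^sup>2 / (2 * \<sigma>\<^sup>2) * (\<integral>z. (norm (g \<theta>' z - g \<theta> z))\<^sup>2 \<partial>std_gaussian)"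
    unfolding eq by (rule G.KL_le[OF base.gauss_generator_axioms])
  moreover have "(\<integral>z. (norm (g \<theta>' z - g \<theta> z))\<^sup>2 \<partial>std_gaussian)
      \<le> (\<integral>z. (h z)\<^sup>2 * (norm (\<theta>' - \<theta>))\<^sup>2 \<partial>std_gaussian)"
    by (rule integral_mono_AE') (use g_lip_sq[OF \<theta>'] h_sq in auto)
  then have "\<alpha>\<^sup>2 / (2 * \<sigma>\<^sup>2) * (\<integral>z. (norm (g \<theta>' z - g \<theta> z))\<^sup>2 \<partial>std_gaussian)
      \<le> \<alpha>\<^sup>2 / (2 * \<sigma>\<^sup>2) * ((\<integral>z. (h z)\<^sup>2 \<partial>std_gaussian) * (norm (\<theta>' - \<theta>))\<^sup>2)"
    by (intro mult_left_mono) auto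
  ultimately show ?thesis
    by (simp add: mult.assoc)
qed

lemma
  assumes \<theta>': "\<theta>' \<in> ball \<theta> r"
  shows integrable_DiKL_integrand: "integrable lborel (DiKL_integrand \<alpha> \<sigma> (model_law g \<theta>') Q)"
    and DiKL_eq: "DiKL \<alpha> \<sigma> (model_law g \<theta>') Q =
      (\<integral>w. log_ratio (\<alpha> *\<^sub>R g \<theta>' (fst w) + \<sigma> *\<^sub>R snd w) \<partial>base.joint) + relative_entropy \<theta>'"
proof -
  interpret G: gauss_generator std_gaussian "g \<theta>'" \<alpha> \<sigma>
    by (rule g_generator[OF \<theta>'])
  note ints = G.integrable_noised_ln_p[OF G.law.gauss_smoothing_axioms]
    G.integrable_noised_ln_p[OF Q.gauss_smoothing_axioms]
    G.integrable_noised_ln_p[OF base.law.gauss_smoothing_axioms]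
  have meas: "(\<lambda>x. ln (G.law.p x) - ln (Q.p x)) \<in> borel_measurable borel"
    by measurable
  show "integrable lborel (DiKL_integrand \<alpha> \<sigma> (model_law g \<theta>') Q)"
    unfolding DiKL_integrand_def[abs_def] model_law_def
    using G.integrable_noised_iff[OF meas] ints by simp
  have "DiKL \<alpha> \<sigma> (model_law g \<theta>') Q = (\<integral>w. ln (G.law.p (G.noised w)) - ln (Q.p (G.noised w)) \<partial>base.joint)"
    unfolding DiKL_def DiKL_integrand_def model_law_def by (rule G.integral_noised[OF meas])
  \<comment> \<open>The base log density is added and subtracted; all three logarithms are
    integrable at this sample.\<close>
  also have "\<dots> = (\<integral>w. log_ratio (G.noised w) \<partial>base.joint)
      + (\<integral>w. ln (G.law.p (G.noised w)) - ln (base.law.p (G.noised w)) \<partial>base.joint)"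
    unfolding log_ratio_def using ints by simp
  finally show "DiKL \<alpha> \<sigma> (model_law g \<theta>') Q =
      (\<integral>w. log_ratio (\<alpha> *\<^sub>R g \<theta>' (fst w) + \<sigma> *\<^sub>R snd w) \<partial>base.joint) + relative_entropy \<theta>'"
    by (simp add: G.noised_def relative_entropy_def model_law_def)
qed

lemma GDERIV_DiKL:
  "GDERIV (\<lambda>\<theta>'. DiKL \<alpha> \<sigma> (model_law g \<theta>') Q) \<theta> :> (\<integral>w. grad_integrand w \<partial>base.joint)"
proof -
  have "((\<lambda>\<theta>'. (\<integral>w. log_ratio (\<alpha> *\<^sub>R g \<theta>' (fst w) + \<sigma> *\<^sub>R snd w) \<partial>base.joint) + relative_entropy \<theta>')
      has_derivative (\<lambda>v. (\<integral>w. v \<bullet> grad_integrand w \<partial>base.joint) + 0)) (at \<theta>)"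
    by (intro has_derivative_add has_derivative_cross_term
        has_derivative_zero_quadratic[OF r_pos relative_entropy_quadratic])
  then have "((\<lambda>\<theta>'. DiKL \<alpha> \<sigma> (model_law g \<theta>') Q)
      has_derivative (\<lambda>v. (\<integral>w. v \<bullet> grad_integrand w \<partial>base.joint) + 0)) (at \<theta>)"
    \<comment> \<open>The decomposition is established only on the ball, which suffices for a
      derivative at its centre.\<close>
    by (rule has_derivative_transform_within_open[of _ _ _ UNIV "ball \<theta> r"])
      (simp_all add: r_pos DiKL_eq)
  then show ?thesis
    by (simp add: gderiv_def integrable_grad_integrand)
qed

end

theorem mainTheorem1:
  fixes E :: "real^'n \<Rightarrow> real"
    and g :: "real^'p \<Rightarrow> real^'m \<Rightarrow> real^'n"
    and \<theta> :: "real^'p"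
    and \<alpha> \<sigma> r :: real
    and h :: "real^'m \<Rightarrow> real"
  assumes E_bdd: "bdd_below (range E)"
    and E_diff: "\<And>x. E differentiable (at x)"
    and E_int: "integrable lborel (\<lambda>x. exp (- E x))"
    and sigma_pos: "0 < \<sigma>"
    and g_meas: "\<And>\<theta>'. g \<theta>' \<in> borel_measurable std_gaussian"
    and g_sq: "integrable std_gaussian (\<lambda>z. (norm (g \<theta> z))\<^sup>2)"
    and g_diff: "AE z in std_gaussian. (\<lambda>\<theta>'. g \<theta>' z) differentiable (at \<theta>)"
    and r_pos: "0 < r"
    and h_meas: "h \<in> borel_measurable std_gaussian"
    and h_sq: "integrable std_gaussian (\<lambda>z. (h z)\<^sup>2)"
    and g_lip: "AE z in std_gaussian. \<forall>\<theta>' \<in> ball \<theta> r. norm (g \<theta>' z - g \<theta> z) \<le> h z * norm (\<theta>' - \<theta>)"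
  shows "(\<forall>xt. (\<lambda>x. ln (convolved_density \<alpha> \<sigma> (model_law g \<theta>) x)) differentiable (at xt) \<and>
               (\<lambda>x. ln (convolved_density \<alpha> \<sigma> (target_law E) x)) differentiable (at xt))
    \<and> (\<forall>\<^sub>F \<theta>' in nhds \<theta>. integrable lborel (DiKL_integrand \<alpha> \<sigma> (model_law g \<theta>') (target_law E)))
    \<and> integrable (std_gaussian \<Otimes>\<^sub>M std_gaussian)
        (\<lambda>(z, \<epsilon>). DiKL_grad_integrand \<alpha> \<sigma> g (target_law E) \<theta> z \<epsilon>)
    \<and> GDERIV (\<lambda>\<theta>'. DiKL \<alpha> \<sigma> (model_law g \<theta>') (target_law E)) \<theta> :>
        (\<integral>(z, \<epsilon>). DiKL_grad_integrand \<alpha> \<sigma> g (target_law E) \<theta> z \<epsilon>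
          \<partial>(std_gaussian \<Otimes>\<^sub>M std_gaussian))"
proof -
  interpret F: lipschitz_generator_family g \<theta> \<alpha> \<sigma> r h "target_law E"
    by (intro lipschitz_generator_family.intro gauss_smoothing_target_law) fact+
  have eq: "(\<lambda>(z, \<epsilon>). DiKL_grad_integrand \<alpha> \<sigma> g (target_law E) \<theta> z \<epsilon>) = F.grad_integrand"
    by (auto simp: F.grad_integrand_eq)
  show ?thesis
    unfolding eq
  proof (intro conjI allI F.integrable_grad_integrand F.GDERIV_DiKL)
    fix xt
    show "(\<lambda>x. ln (convolved_density \<alpha> \<sigma> (model_law g \<theta>) x)) differentiable (at xt)"
      unfolding model_law_def by (rule differentiableI[OF F.base.law.has_derivative_ln_p])
    show "(\<lambda>x. ln (convolved_density \<alpha> \<sigma> (target_law E) x)) differentiable (at xt)"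
      by (rule differentiableI[OF F.Q.has_derivative_ln_p])
  next
    show "\<forall>\<^sub>F \<theta>' in nhds \<theta>. integrable lborel (DiKL_integrand \<alpha> \<sigma> (model_law g \<theta>') (target_law E))"
      using eventually_nhds_ball[OF r_pos] by eventually_elim (rule F.integrable_DiKL_integrand)
  qed
qed

end
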